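(* Let $V$ be a 6-dimensional real vector space. The almost complex structure $\mathcal J_2$ on the open submanifold $U_-\subset\Lambda^3V^*$ defined, for $\zeta\in U_-$ and $\Omega\in T_\zeta U_-=\Lambda^3V^*$, by $$(\mathcal J_2(\zeta)\Omega)(v_1,v_2,v_3)=\tfrac12\Omega(Jv_1,Jv_2,Jv_3)+\tfrac12\big[\Omega(Jv_1,v_2,v_3)+\Omega(v_1,Jv_2,v_3)+\Omega(v_1,v_2,Jv_3)\big],\qquad J=J(\zeta),$$ is integrable.
   Context: $V$ is a 6-dimensional real vector space. $U_-\subset\Lambda^3V^*$ is the (open) $GL(V)$-orbit, under pullback, of $\omega_-=\alpha_1\wedge\alpha_2\wedge\alpha_3+\alpha_1\wedge\alpha_4\wedge\alpha_5+\alpha_2\wedge\alpha_4\wedge\alpha_6-\alpha_3\wedge\alpha_5\wedge\alpha_6$, where $\alpha_1,\dots,\alpha_6$ is a basis of $V^*$. Fix a nonzero $\theta_0\in\Lambda^6V^*$. For each $\zeta\in U_-$ there are a unique 6-form $\theta(\zeta)=a\theta_0$ with $a>0$ and a unique automorphism $J(\zeta)$ of $V$ with $J(\zeta)^2=-I$ such that $(\iota_v\zeta)\wedge\zeta=\iota_{J(\zeta)v}\theta(\zeta)$ for all $v\in V$; $J$ depends smoothly on $\zeta$. An almost complex structure $\mathcal J$ is called integrable if its Nijenhuis tensor vanishes, i.e. $[\mathcal J X,\mathcal J Y]-[X,Y]-\mathcal J[\mathcal J X,Y]-\mathcal J[X,\mathcal J Y]=0$ for all vector fields $X,Y$. *)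

theory Defs
  imports "HOL-Analysis.Analysis" "HOL-Combinatorics.Permutations"
begin

section \<open>Exterior forms\<close>

text \<open>A \<open>k\<close>-form is a function on lists of vectors; it is normalised to be \<open>0\<close> on lists
  whose length is not \<open>k\<close>, so that equality of forms is equality of functions.\<close>

definition is_form :: "nat \<Rightarrow> ('v::real_vector list \<Rightarrow> real) \<Rightarrow> bool" where
  "is_form k \<omega> \<longleftrightarrow>
     (\<forall>vs. length vs \<noteq> k \<longrightarrow> \<omega> vs = 0) \<and>
     (\<forall>vs i. length vs = k \<longrightarrow> i < k \<longrightarrow> linear (\<lambda>v. \<omega> (vs[i := v]))) \<and>
     (\<forall>vs i j. length vs = k \<longrightarrow> i < j \<longrightarrow> j < k \<longrightarrow> vs ! i = vs ! j \<longrightarrow> \<omega> vs = 0)"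

definition wedge :: "nat \<Rightarrow> nat \<Rightarrow> ('v list \<Rightarrow> real) \<Rightarrow> ('v list \<Rightarrow> real) \<Rightarrow> 'v list \<Rightarrow> real" where
  "wedge p q \<omega> \<eta> vs =
     (if length vs = p + q
      then (\<Sum>\<sigma> | \<sigma> permutes {..<p + q}. of_int (sign \<sigma>) *
              \<omega> (map (\<lambda>i. vs ! \<sigma> i) [0..<p]) * \<eta> (map (\<lambda>i. vs ! \<sigma> i) [p..<p + q]))
           / (fact p * fact q)
      else 0)"

definition interior_prod :: "'v \<Rightarrow> ('v list \<Rightarrow> real) \<Rightarrow> 'v list \<Rightarrow> real" where
  "interior_prod v \<omega> vs = \<omega> (v # vs)"

definition covector_form :: "('v::real_normed_vector \<Rightarrow>\<^sub>L real) \<Rightarrow> 'v list \<Rightarrow> real" where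
  "covector_form a vs = (if length vs = 1 then blinfun_apply a (hd vs) else 0)"

definition wedge3 ::
  "('v::real_normed_vector \<Rightarrow>\<^sub>L real) \<Rightarrow> ('v \<Rightarrow>\<^sub>L real) \<Rightarrow> ('v \<Rightarrow>\<^sub>L real) \<Rightarrow> 'v list \<Rightarrow> real" where
  "wedge3 a b c =
     wedge 1 2 (covector_form a) (wedge 1 1 (covector_form b) (covector_form c))"


section \<open>The vector space of 3-forms\<close>

typedef (overloaded) ('v::euclidean_space) form3 = "{\<omega> :: 'v list \<Rightarrow> real. is_form 3 \<omega>}"
  morphisms form3_apply Abs_form3
  by (rule exI[of _ "\<lambda>_. 0"]) (simp add: is_form_def linear_iff)

setup_lifting type_definition_form3

lemma form3_eqI: "(\<And>vs. form3_apply \<omega> vs = form3_apply \<eta> vs) \<Longrightarrow> \<omega> = \<eta>"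
  by (metis ext form3_apply_inject)

lemma is_form3_iff:
  "is_form 3 \<omega> \<longleftrightarrow>
     (\<forall>vs. length vs \<noteq> 3 \<longrightarrow> \<omega> vs = 0) \<and>
     (\<forall>b c. linear (\<lambda>v. \<omega> [v, b, c])) \<and>
     (\<forall>a c. linear (\<lambda>v. \<omega> [a, v, c])) \<and>
     (\<forall>a b. linear (\<lambda>v. \<omega> [a, b, v])) \<and>
     (\<forall>a b. \<omega> [a, a, b] = 0) \<and> (\<forall>a b. \<omega> [a, b, a] = 0) \<and> (\<forall>a b. \<omega> [b, a, a] = 0)"
  (is "?L \<longleftrightarrow> ?R")
proof
  assume L: ?L
  have lin: "linear (\<lambda>v. \<omega> ([a, b, c][i := v]))" if "i < 3" for a b c i
    using L that unfolding is_form_def by (metis length_Cons list.size(3) numeral_3_eq_3)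
  have alt: "\<omega> [a, b, c] = 0" if "i < j" "j < 3" "[a, b, c] ! i = [a, b, c] ! j" for a b c i j
    using L that unfolding is_form_def by (metis length_Cons list.size(3) numeral_3_eq_3)
  show ?R
    using L lin[of 0] lin[of 1] lin[of 2] alt[of 0 1] alt[of 0 2] alt[of 1 2]
    by (auto simp: is_form_def numeral_2_eq_2)
next
  assume R: ?R
  have 3: "\<exists>a b c. vs = [a, b, c]" if "length vs = 3" for vs :: "'a list"
    using that by (auto simp: numeral_3_eq_3 length_Suc_conv)
  show ?L
    unfolding is_form_def
  proof (intro conjI allI impI)
    fix vs :: "'a list" assume "length vs \<noteq> 3" then show "\<omega> vs = 0" using R by blast
  next
    fix vs :: "'a list" and i :: nat assume "length vs = 3" "i < 3"
    moreover from this have "i = 0 \<or> i = 1 \<or> i = 2" by linarith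
    ultimately show "linear (\<lambda>v. \<omega> (vs[i := v]))" using R 3[of vs] by (auto simp: numeral_2_eq_2)
  next
    fix vs :: "'a list" and i j :: nat
    assume "length vs = 3" "i < j" "j < 3" "vs ! i = vs ! j"
    moreover from this have "i = 0 \<and> j = 1 \<or> i = 0 \<and> j = 2 \<or> i = 1 \<and> j = 2" by linarith
    ultimately show "\<omega> vs = 0" using R 3[of vs] by (auto simp: numeral_2_eq_2)
  qed
qed

lemma form3_length: "length vs \<noteq> 3 \<Longrightarrow> form3_apply \<omega> vs = 0"
  using form3_apply[of \<omega>] by (auto simp: is_form_def)

lemma form3_linear:
  "linear (\<lambda>v. form3_apply \<omega> [v, b, c])"
  "linear (\<lambda>v. form3_apply \<omega> [a, v, c])"
  "linear (\<lambda>v. form3_apply \<omega> [a, b, v])"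
  using form3_apply[of \<omega>] by (auto simp: is_form3_iff)

lemma form3_alternating:
  "form3_apply \<omega> [a, a, b] = 0" "form3_apply \<omega> [a, b, a] = 0" "form3_apply \<omega> [b, a, a] = 0"
  using form3_apply[of \<omega>] by (auto simp: is_form3_iff)

lemma form3_swap:
  "form3_apply \<omega> [b, a, c] = - form3_apply \<omega> [a, b, c]"
  "form3_apply \<omega> [a, c, b] = - form3_apply \<omega> [a, b, c]"
  "form3_apply \<omega> [c, b, a] = - form3_apply \<omega> [a, b, c]"
proof -
  note add = form3_linear[THEN linear_add]
  have "form3_apply \<omega> [a, b, c] + form3_apply \<omega> [b, a, c] = 0"
    using form3_alternating(1)[of \<omega> "a + b" c] unfolding add
    by (simp add: form3_alternating)
  then show "form3_apply \<omega> [b, a, c] = - form3_apply \<omega> [a, b, c]" by linarith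
  have "form3_apply \<omega> [a, b, c] + form3_apply \<omega> [a, c, b] = 0"
    using form3_alternating(3)[of \<omega> a "b + c"] unfolding add
    by (simp add: form3_alternating)
  then show "form3_apply \<omega> [a, c, b] = - form3_apply \<omega> [a, b, c]" by linarith
  have "form3_apply \<omega> [a, b, c] + form3_apply \<omega> [c, b, a] = 0"
    using form3_alternating(2)[of \<omega> "a + c" b] unfolding add
    by (simp add: form3_alternating)
  then show "form3_apply \<omega> [c, b, a] = - form3_apply \<omega> [a, b, c]" by linarith
qed

instantiation form3 :: (euclidean_space) real_inner
begin

lift_definition zero_form3 :: "'a form3" is "\<lambda>_. 0"
  by (simp add: is_form_def linear_iff)
lift_definition plus_form3 :: "'a form3 \<Rightarrow> 'a form3 \<Rightarrow> 'a form3" is "\<lambda>\<omega> \<eta> vs. \<omega> vs + \<eta> vs"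
  by (simp add: is_form_def linear_compose_add)
lift_definition minus_form3 :: "'a form3 \<Rightarrow> 'a form3 \<Rightarrow> 'a form3" is "\<lambda>\<omega> \<eta> vs. \<omega> vs - \<eta> vs"
  by (simp add: is_form_def linear_compose_sub)
lift_definition uminus_form3 :: "'a form3 \<Rightarrow> 'a form3" is "\<lambda>\<omega> vs. - \<omega> vs"
  by (simp add: is_form_def linear_compose_neg)
lift_definition scaleR_form3 :: "real \<Rightarrow> 'a form3 \<Rightarrow> 'a form3" is "\<lambda>r \<omega> vs. r * \<omega> vs"
  by (auto simp: is_form_def linear_iff algebra_simps)

text \<open>All norms on the finite-dimensional space of 3-forms define the same smooth structure;
  the one used here is Euclidean.\<close>

definition inner_form3 :: "'a form3 \<Rightarrow> 'a form3 \<Rightarrow> real" where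
  "inner_form3 \<omega> \<eta> =
     (\<Sum>a\<in>Basis. \<Sum>b\<in>Basis. \<Sum>c\<in>Basis. form3_apply \<omega> [a, b, c] * form3_apply \<eta> [a, b, c])"
definition norm_form3 :: "'a form3 \<Rightarrow> real" where
  "norm_form3 \<omega> = sqrt (inner \<omega> \<omega>)"
definition sgn_form3 :: "'a form3 \<Rightarrow> 'a form3" where
  "sgn_form3 \<omega> = scaleR (inverse (norm \<omega>)) \<omega>"
definition dist_form3 :: "'a form3 \<Rightarrow> 'a form3 \<Rightarrow> real" where
  "dist_form3 \<omega> \<eta> = norm (\<omega> - \<eta>)"
definition uniformity_form3 :: "('a form3 \<times> 'a form3) filter" where
  "uniformity_form3 = (INF e\<in>{0<..}. principal {(x, y). dist x y < e})"
definition open_form3 :: "'a form3 set \<Rightarrow> bool" where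
  "open_form3 U \<longleftrightarrow> (\<forall>x\<in>U. \<forall>\<^sub>F (x', y) in uniformity. x' = x \<longrightarrow> y \<in> U)"

instance
proof
  fix x y z :: "'a form3" and r s :: real
  show "x + y + z = x + (y + z)" by transfer (simp add: add.assoc)
  show "x + y = y + x" by transfer (simp add: add.commute)
  show "0 + x = x" by transfer simp
  show "- x + x = 0" by transfer simp
  show "x - y = x + - y" by transfer simp
  show "r *\<^sub>R (x + y) = r *\<^sub>R x + r *\<^sub>R y" by transfer (simp add: distrib_left)
  show "(r + s) *\<^sub>R x = r *\<^sub>R x + s *\<^sub>R x" by transfer (simp add: distrib_right)
  show "r *\<^sub>R s *\<^sub>R x = (r * s) *\<^sub>R x" by transfer (simp add: mult.assoc)
  show "1 *\<^sub>R x = x" by transfer simp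
  show "dist x y = norm (x - y)" by (rule dist_form3_def)
  show "sgn x = scaleR (inverse (norm x)) x" by (rule sgn_form3_def)
  show "uniformity = (INF e\<in>{0<..}. principal {(x, y :: 'a form3). dist x y < e})"
    by (rule uniformity_form3_def)
  show "open U \<longleftrightarrow> (\<forall>x\<in>U. \<forall>\<^sub>F (x', y) in uniformity. x' = x \<longrightarrow> y \<in> U)" for U :: "'a form3 set"
    by (rule open_form3_def)
  show "inner x y = inner y x" by (simp add: inner_form3_def mult.commute)
  show "inner (x + y) z = inner x z + inner y z"
    by (simp add: inner_form3_def plus_form3.rep_eq distrib_right sum.distrib)
  show "inner (r *\<^sub>R x) y = r * inner x y"
    by (simp add: inner_form3_def scaleR_form3.rep_eq sum_distrib_left mult.assoc)
  show "0 \<le> inner x x" by (simp add: inner_form3_def sum_nonneg)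
  show "norm x = sqrt (inner x x)" by (rule norm_form3_def)
  show "inner x x = 0 \<longleftrightarrow> x = 0"
  proof
    assume "x = 0" then show "inner x x = 0" by (simp add: inner_form3_def zero_form3.rep_eq)
  next
    assume "inner x x = 0"
    then have 0: "form3_apply x [a, b, c] = 0" if "a \<in> Basis" "b \<in> Basis" "c \<in> Basis" for a b c
      using that by (simp add: inner_form3_def sum_nonneg_eq_0_iff sum_nonneg)
    have 1: "form3_apply x [a, b, c] = 0" if "a \<in> Basis" "b \<in> Basis" for a b c
      using linear_eq_0_on_span[OF form3_linear(3), of Basis x a b c] 0 that by auto
    have 2: "form3_apply x [a, b, c] = 0" if "a \<in> Basis" for a b c
      using linear_eq_0_on_span[OF form3_linear(2), of Basis x a c b] 1 that by auto
    have 3: "form3_apply x [a, b, c] = 0" for a b c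
      using linear_eq_0_on_span[OF form3_linear(1), of Basis x b c a] 2 by auto
    have "form3_apply x vs = 0" for vs
    proof (cases "length vs = 3")
      case True
      then obtain a b c where "vs = [a, b, c]" by (auto simp: numeral_3_eq_3 length_Suc_conv)
      then show ?thesis using 3 by simp
    qed (rule form3_length)
    then show "x = 0" by (intro form3_eqI) (simp add: zero_form3.rep_eq)
  qed
qed

end


section \<open>Almost complex structures and integrability\<close>

text \<open>The following notions are meant for open \<open>U\<close>; tangent spaces and vector fields are
  identified with the ambient vector space and with functions into it.\<close>

fun C_k_on :: "nat \<Rightarrow> 'a::real_normed_vector set \<Rightarrow> ('a \<Rightarrow> 'b::real_normed_vector) \<Rightarrow> bool" where
  "C_k_on 0 U f \<longleftrightarrow> continuous_on U f"
| "C_k_on (Suc k) U f \<longleftrightarrow>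
     (\<forall>x\<in>U. f differentiable (at x)) \<and> (\<forall>v. C_k_on k U (\<lambda>x. frechet_derivative f (at x) v))"

definition smooth_on :: "'a::real_normed_vector set \<Rightarrow> ('a \<Rightarrow> 'b::real_normed_vector) \<Rightarrow> bool" where
  "smooth_on U f \<longleftrightarrow> (\<forall>k. C_k_on k U f)"

definition lie_bracket :: "('a::real_normed_vector \<Rightarrow> 'a) \<Rightarrow> ('a \<Rightarrow> 'a) \<Rightarrow> 'a \<Rightarrow> 'a" where
  "lie_bracket X Y x = frechet_derivative Y (at x) (X x) - frechet_derivative X (at x) (Y x)"

text \<open>In finite dimensions, smoothness of \<open>\<lambda>x. J x v\<close> for every \<open>v\<close> is smoothness of
  \<open>J\<close> as a field of endomorphisms.\<close>

definition almost_complex_structure_on ::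
  "'a::real_normed_vector set \<Rightarrow> ('a \<Rightarrow> 'a \<Rightarrow> 'a) \<Rightarrow> bool" where
  "almost_complex_structure_on U J \<longleftrightarrow>
     (\<forall>x\<in>U. linear (J x) \<and> (\<forall>v. J x (J x v) = - v)) \<and> (\<forall>v. smooth_on U (\<lambda>x. J x v))"

definition nijenhuis ::
  "('a::real_normed_vector \<Rightarrow> 'a \<Rightarrow> 'a) \<Rightarrow> ('a \<Rightarrow> 'a) \<Rightarrow> ('a \<Rightarrow> 'a) \<Rightarrow> 'a \<Rightarrow> 'a" where
  "nijenhuis J X Y x =
     lie_bracket (\<lambda>y. J y (X y)) (\<lambda>y. J y (Y y)) x - lie_bracket X Y x
     - J x (lie_bracket (\<lambda>y. J y (X y)) Y x) - J x (lie_bracket X (\<lambda>y. J y (Y y)) x)"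

definition integrable_acs_on ::
  "'a::real_normed_vector set \<Rightarrow> ('a \<Rightarrow> 'a \<Rightarrow> 'a) \<Rightarrow> bool" where
  "integrable_acs_on U J \<longleftrightarrow> almost_complex_structure_on U J \<and>
     (\<forall>X Y. smooth_on U X \<longrightarrow> smooth_on U Y \<longrightarrow> (\<forall>x\<in>U. nijenhuis J X Y x = 0))"


section \<open>The orbit and its almost complex structure\<close>

definition is_dual_basis :: "(nat \<Rightarrow> 'v::euclidean_space \<Rightarrow>\<^sub>L real) \<Rightarrow> bool" where
  "is_dual_basis \<alpha> \<longleftrightarrow>
     inj_on \<alpha> {1..6} \<and> independent (\<alpha> ` {1..6}) \<and> span (\<alpha> ` {1..6}) = UNIV"

definition omega_minus :: "(nat \<Rightarrow> 'v::euclidean_space \<Rightarrow>\<^sub>L real) \<Rightarrow> 'v list \<Rightarrow> real" where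
  "omega_minus \<alpha> vs =
     wedge3 (\<alpha> 1) (\<alpha> 2) (\<alpha> 3) vs + wedge3 (\<alpha> 1) (\<alpha> 4) (\<alpha> 5) vs
     + wedge3 (\<alpha> 2) (\<alpha> 4) (\<alpha> 6) vs - wedge3 (\<alpha> 3) (\<alpha> 5) (\<alpha> 6) vs"

definition U_minus :: "(nat \<Rightarrow> 'v::euclidean_space \<Rightarrow>\<^sub>L real) \<Rightarrow> 'v form3 set" where
  "U_minus \<alpha> = {\<zeta>. \<exists>A :: 'v \<Rightarrow>\<^sub>L 'v. bij (blinfun_apply A) \<and>
     (\<forall>vs. form3_apply \<zeta> vs = omega_minus \<alpha> (map (blinfun_apply A) vs))}"

text \<open>\<open>J\<close> and the factor \<open>a > 0\<close> exist and are unique for \<open>\<zeta>\<close> in the orbit; elsewhere the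
  value is unspecified. Linear maps of \<open>V\<close> are taken as bounded linear maps, which is no
  restriction in finite dimension.\<close>

definition J_form :: "('v::euclidean_space list \<Rightarrow> real) \<Rightarrow> 'v form3 \<Rightarrow> 'v \<Rightarrow>\<^sub>L 'v" where
  "J_form \<theta>\<^sub>0 \<zeta> = (THE J. (\<forall>v. blinfun_apply J (blinfun_apply J v) = - v) \<and>
     (\<exists>a>0. \<forall>v. wedge 2 3 (interior_prod v (form3_apply \<zeta>)) (form3_apply \<zeta>)
                = interior_prod (blinfun_apply J v) (\<lambda>vs. a * \<theta>\<^sub>0 vs)))"

definition J2_fun :: "('v \<Rightarrow> 'v) \<Rightarrow> ('v list \<Rightarrow> real) \<Rightarrow> 'v list \<Rightarrow> real" where
  "J2_fun J \<omega> vs = (case vs of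
     [v1, v2, v3] \<Rightarrow> 1/2 * \<omega> [J v1, J v2, J v3]
        + 1/2 * (\<omega> [J v1, v2, v3] + \<omega> [v1, J v2, v3] + \<omega> [v1, v2, J v3])
   | _ \<Rightarrow> 0)"

lemma is_form_J2_fun:
  fixes J :: "'v::euclidean_space \<Rightarrow> 'v"
  assumes J: "linear J" and "is_form 3 \<omega>"
  shows "is_form 3 (J2_fun J \<omega>)"
proof -
  obtain \<Omega> where \<omega>: "\<omega> = form3_apply \<Omega>"
    using assms form3_apply_cases[of \<omega>] by auto
  note lin = form3_linear[THEN linear_add] form3_linear[THEN linear_scale]
  show ?thesis
    unfolding is_form3_iff \<omega>
  proof (intro conjI allI impI)
    fix vs :: "'v list" assume "length vs \<noteq> 3"
    then show "J2_fun J (form3_apply \<Omega>) vs = 0" by (auto simp: J2_fun_def split: list.split)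
  next
    fix a b :: 'v
    show "J2_fun J (form3_apply \<Omega>) [a, a, b] = 0"
      using form3_swap(1)[of \<Omega> "J a" a b] by (simp add: J2_fun_def form3_alternating)
    show "J2_fun J (form3_apply \<Omega>) [a, b, a] = 0"
      using form3_swap(3)[of \<Omega> "J a" b a] by (simp add: J2_fun_def form3_alternating)
    show "J2_fun J (form3_apply \<Omega>) [b, a, a] = 0"
      using form3_swap(2)[of \<Omega> b "J a" a] by (simp add: J2_fun_def form3_alternating)
  qed (simp_all add: J2_fun_def linear_iff linear_add[OF J] linear_scale[OF J] lin field_simps)
qed

lift_definition J2_op :: "('v::euclidean_space \<Rightarrow>\<^sub>L 'v) \<Rightarrow> 'v form3 \<Rightarrow> 'v form3" is
  "\<lambda>J. J2_fun (blinfun_apply J)"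
  by (intro is_form_J2_fun blinfun.bounded_linear_right[THEN bounded_linear.linear])

definition J2 :: "('v::euclidean_space list \<Rightarrow> real) \<Rightarrow> 'v form3 \<Rightarrow> 'v form3 \<Rightarrow> 'v form3" where
  "J2 \<theta>\<^sub>0 \<zeta> \<Omega> = J2_op (J_form \<theta>\<^sub>0 \<zeta>) \<Omega>"

end

theory Submission
  imports Defs
begin

text \<open>Put \<open>F(\<zeta>) = - \<zeta>(J\<cdot>, J\<cdot>, J\<cdot>)\<close> with \<open>J = J(\<zeta>)\<close>. Since \<open>\<zeta>\<close> is the real part of a form of type
  \<open>(3, 0)\<close>, \<open>\<zeta>(J v, w, u) = \<zeta>(v, J w, u)\<close>; differentiating this relation and \<open>J\<^sup>2 = - 1\<close> shows that
  \<open>J2\<close> is the differential of \<open>F\<close>. An almost complex structure that is the differential of a map has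
  vanishing Nijenhuis tensor, by the symmetry of second derivatives. Openness of the orbit follows from
  the surjectivity of the differential of the orbit map at the model form, and \<open>J\<close> is smooth because
  it is a quadratic polynomial in \<open>\<zeta>\<close> divided by the square root of a positive quartic one.\<close>

section \<open>Calculus\<close>

text \<open>The type \<open>form3\<close> is only a real inner product space, with no basis at hand,
  while the scalar arguments (mean value theorem, open mapping, products of coordinates) need one. A
  frame takes its place: a finite, possibly redundant family \<open>E\<close> with bounded
  coordinate functionals \<open>c\<close> that reproduce every vector. Derivatives, continuity,
  smoothness and the symmetry of second derivatives are thereby all reduced to scalar functions. The
  potential has a classical source. If zeta is the real part of the (3,0)-form Psi = zeta + i eta,
  then F(zeta) = Re(i Psi) = - eta, so F passes from the real part to minus the imaginary part. The
  algebraic facts about J are checked on the model form only and carried along the orbit by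
  pullback. What pullback does not determine is the sign of J; the requirement a > 0 fixes
  it.\<close>

definition finite_frame ::
  "'i set \<Rightarrow> ('i \<Rightarrow> 'a::real_normed_vector \<Rightarrow> real) \<Rightarrow> ('i \<Rightarrow> 'a) \<Rightarrow> bool" where
  "finite_frame S c E \<longleftrightarrow>
     finite S \<and> (\<forall>i. bounded_linear (c i)) \<and> (\<forall>v. (\<Sum>i\<in>S. c i v *\<^sub>R E i) = v)"

lemma finite_frame_Basis:
  "finite_frame (Basis :: 'a::euclidean_space set) (\<lambda>b v. v \<bullet> b) (\<lambda>b. b)"
  unfolding finite_frame_def
  by (auto simp: euclidean_representation intro: bounded_linear_inner_left)

lemma has_derivative_frame:
  fixes f :: "'a::real_normed_vector \<Rightarrow> 'b::real_normed_vector" and E :: "'i \<Rightarrow> 'b"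
  assumes fr: "finite_frame S c E"
    and der: "\<And>i. i \<in> S \<Longrightarrow> ((\<lambda>y. c i (f y)) has_derivative (\<lambda>h. c i (f' h))) (at x)"
  shows "(f has_derivative f') (at x)"
proof -
  have rep: "\<And>v. (\<Sum>i\<in>S. c i v *\<^sub>R E i) = v" using fr by (simp add: finite_frame_def)
  have "((\<lambda>y. \<Sum>i\<in>S. c i (f y) *\<^sub>R E i) has_derivative (\<lambda>h. \<Sum>i\<in>S. c i (f' h) *\<^sub>R E i)) (at x)"
    by (intro has_derivative_sum has_derivative_scaleR_left der)
  then show ?thesis by (simp add: rep)
qed

text \<open>A product rule for a field of linear maps of which only the values on fixed vectors are
  known to be differentiable. Expanding the argument in a frame turns it into finitely many
  scalar-times-vector products.\<close>

lemma has_derivative_apply_linear: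
  fixes M :: "'a::real_normed_vector \<Rightarrow> 'b::real_normed_vector \<Rightarrow> 'c::real_normed_vector"
    and E :: "'i \<Rightarrow> 'b"
  assumes fr: "finite_frame S c E"
    and U: "open U" "x \<in> U"
    and lin: "\<And>y. y \<in> U \<Longrightarrow> linear (M y)"
    and M: "\<And>v. ((\<lambda>y. M y v) has_derivative (\<lambda>u. M' u v)) (at x)"
    and X: "(X has_derivative X') (at x)"
  shows "((\<lambda>y. M y (X y)) has_derivative (\<lambda>u. M' u (X x) + M x (X' u))) (at x)"
proof -
  have rep: "\<And>v. (\<Sum>i\<in>S. c i v *\<^sub>R E i) = v" and c: "\<And>i. bounded_linear (c i)"
    using fr by (auto simp: finite_frame_def)
  have Mrep: "(\<Sum>i\<in>S. c i v *\<^sub>R M y (E i)) = M y v" if "y \<in> U" for y v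
  proof -
    have "M y (\<Sum>i\<in>S. c i v *\<^sub>R E i) = (\<Sum>i\<in>S. c i v *\<^sub>R M y (E i))"
      by (simp add: linear_sum[OF lin[OF that]] linear_scale[OF lin[OF that]])
    then show ?thesis by (simp add: rep)
  qed
  \<comment> \<open>Linearity of \<open>M' u\<close> in the vector is not assumed; uniqueness of
    derivatives supplies it.\<close>
  have M'rep: "(\<Sum>i\<in>S. c i v *\<^sub>R M' u (E i)) = M' u v" for u v
  proof -
    have "((\<lambda>y. \<Sum>i\<in>S. c i v *\<^sub>R M y (E i)) has_derivative
            (\<lambda>u. \<Sum>i\<in>S. c i v *\<^sub>R M' u (E i))) (at x)"
      by (intro has_derivative_sum has_derivative_scaleR_right M)
    then have "((\<lambda>y. M y v) has_derivative (\<lambda>u. \<Sum>i\<in>S. c i v *\<^sub>R M' u (E i))) (at x)"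
      by (rule has_derivative_transform_within_open[OF _ U]) (simp add: Mrep)
    from has_derivative_unique[OF this M] show ?thesis by (simp add: fun_eq_iff)
  qed
  have "((\<lambda>y. \<Sum>i\<in>S. c i (X y) *\<^sub>R M y (E i)) has_derivative
          (\<lambda>u. \<Sum>i\<in>S. c i (X x) *\<^sub>R M' u (E i) + c i (X' u) *\<^sub>R M x (E i))) (at x)"
    by (intro has_derivative_sum has_derivative_scaleR M bounded_linear.has_derivative[OF c] X)
  moreover have "(\<Sum>i\<in>S. c i (X x) *\<^sub>R M' u (E i) + c i (X' u) *\<^sub>R M x (E i)) = M' u (X x) + M x (X' u)"
    for u using U by (simp add: sum.distrib Mrep M'rep)
  ultimately have "((\<lambda>y. \<Sum>i\<in>S. c i (X y) *\<^sub>R M y (E i)) has_derivative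
          (\<lambda>u. M' u (X x) + M x (X' u))) (at x)" by simp
  then show ?thesis
    by (rule has_derivative_transform_within_open[OF _ U]) (simp add: Mrep)
qed

section \<open>Calculus of C^k and smooth functions on open sets\<close>

lemma frechet_derivative_cong_open:
  assumes "open U" "x \<in> U" "\<And>y. y \<in> U \<Longrightarrow> f y = g y"
  shows "frechet_derivative f (at x) = frechet_derivative g (at x)"
proof -
  \<comment> \<open>Both derivatives are chosen by the same description once these predicates agree,
    which also covers points without a derivative.\<close>
  have "(f has_derivative D) (at x) \<longleftrightarrow> (g has_derivative D) (at x)" for D
    using assms has_derivative_transform_within_open[of f D x UNIV U g]
      has_derivative_transform_within_open[of g D x UNIV U f] by auto
  then show ?thesis by (simp add: frechet_derivative_def)
qed

lemma differentiable_cong_open: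
  assumes "open U" "x \<in> U" "\<And>y. y \<in> U \<Longrightarrow> f y = g y" "f differentiable (at x)"
  shows "g differentiable (at x)"
  using assms has_derivative_transform_within_open[of f _ x UNIV U g]
  by (auto simp: differentiable_def)

lemma C_k_on_cong:
  assumes "open U" "\<And>x. x \<in> U \<Longrightarrow> f x = g x" "C_k_on k U f"
  shows "C_k_on k U g"
  using assms(2,3)
proof (induction k arbitrary: f g)
  case 0
  then show ?case using continuous_on_cong[of U U f g] by simp
next
  case (Suc k)
  have "g differentiable at x" if "x \<in> U" for x
    using differentiable_cong_open[OF assms(1) that, of f g] Suc.prems that by auto
  moreover have "C_k_on k U (\<lambda>x. frechet_derivative g (at x) v)" for v
  proof (rule Suc.IH)
    show "C_k_on k U (\<lambda>x. frechet_derivative f (at x) v)" using Suc.prems by simp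
  qed (use frechet_derivative_cong_open[OF assms(1), of _ f g] Suc.prems in auto)
  ultimately show ?case by simp
qed

lemma C_k_on_Suc_derivI:
  assumes "open U" "\<And>x. x \<in> U \<Longrightarrow> (f has_derivative D x) (at x)"
    and "\<And>v. C_k_on k U (\<lambda>x. D x v)"
  shows "C_k_on (Suc k) U f"
  using assms frechet_derivative_at[OF assms(2)]
  by (auto simp: differentiable_def intro!: C_k_on_cong[OF assms(1) _ assms(3)])

lemma C_k_on_Suc_derivD:
  assumes "C_k_on (Suc k) U f" "x \<in> U"
  shows "(f has_derivative frechet_derivative f (at x)) (at x)"
  using assms frechet_derivative_works by auto

lemma C_k_on_mono: "C_k_on (Suc k) U f \<Longrightarrow> C_k_on k U f"
proof (induction k arbitrary: f)
  case 0
  then show ?case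
    by (auto intro!: continuous_at_imp_continuous_on differentiable_imp_continuous_within)
next
  case (Suc k)
  then show ?case by (metis C_k_on.simps(2))
qed

lemma C_k_on_const: "C_k_on k U (\<lambda>x. a)"
  by (induction k arbitrary: a) (auto simp: frechet_derivative_const)

lemma C_k_on_bounded_linear_compose:
  assumes "open U" "bounded_linear T" "C_k_on k U f"
  shows "C_k_on k U (\<lambda>x. T (f x))"
  using assms(3)
proof (induction k arbitrary: f)
  case 0
  then show ?case using bounded_linear.continuous_on[OF assms(2)] by simp
next
  case (Suc k)
  show ?case
  proof (rule C_k_on_Suc_derivI[OF assms(1)])
    show "((\<lambda>x. T (f x)) has_derivative (\<lambda>v. T (frechet_derivative f (at x) v))) (at x)"
      if "x \<in> U" for x
      by (rule bounded_linear.has_derivative[OF assms(2)])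
        (rule C_k_on_Suc_derivD[OF Suc.prems that])
    show "C_k_on k U (\<lambda>x. T (frechet_derivative f (at x) v))" for v
      by (rule Suc.IH) (use Suc.prems in simp)
  qed
qed

lemma C_k_on_linear:
  assumes "open U" "bounded_linear T"
  shows "C_k_on k U T"
proof (cases k)
  case 0
  then show ?thesis using linear_continuous_on[OF assms(2)] by simp
next
  case (Suc k')
  have "C_k_on (Suc k') U T"
    by (rule C_k_on_Suc_derivI[OF assms(1) bounded_linear_imp_has_derivative[OF assms(2)]])
      (rule C_k_on_const)
  then show ?thesis by (simp add: Suc)
qed

lemma C_k_on_add:
  assumes "open U" "C_k_on k U f" "C_k_on k U g"
  shows "C_k_on k U (\<lambda>x. f x + g x)"
  using assms(2,3)
proof (induction k arbitrary: f g)
  case 0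
  then show ?case by (simp add: continuous_on_add)
next
  case (Suc k)
  show ?case
  proof (rule C_k_on_Suc_derivI[OF assms(1)])
    show "((\<lambda>x. f x + g x) has_derivative
        (\<lambda>v. frechet_derivative f (at x) v + frechet_derivative g (at x) v)) (at x)"
      if "x \<in> U" for x
      by (intro has_derivative_add C_k_on_Suc_derivD[OF Suc.prems(1) that] C_k_on_Suc_derivD[OF Suc.prems(2) that])
    show "C_k_on k U (\<lambda>x. frechet_derivative f (at x) v + frechet_derivative g (at x) v)" for v
      by (rule Suc.IH) (use Suc.prems in simp_all)
  qed
qed

lemma C_k_on_mult:
  fixes f g :: "'a::real_normed_vector \<Rightarrow> real"
  assumes "open U" "C_k_on k U f" "C_k_on k U g"
  shows "C_k_on k U (\<lambda>x. f x * g x)"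
  using assms(2,3)
proof (induction k arbitrary: f g)
  case 0
  then show ?case by (simp add: continuous_on_mult)
next
  case (Suc k)
  show ?case
  proof (rule C_k_on_Suc_derivI[OF assms(1)])
    show "((\<lambda>x. f x * g x) has_derivative
        (\<lambda>v. f x * frechet_derivative g (at x) v + frechet_derivative f (at x) v * g x)) (at x)"
      if "x \<in> U" for x
      by (intro has_derivative_mult C_k_on_Suc_derivD[OF Suc.prems(1) that] C_k_on_Suc_derivD[OF Suc.prems(2) that])
    show "C_k_on k U (\<lambda>x. f x * frechet_derivative g (at x) v + frechet_derivative f (at x) v * g x)"
      for v
      by (intro C_k_on_add[OF assms(1)] Suc.IH) (use Suc.prems C_k_on_mono in auto)
  qed
qed

text \<open>For h = f^(-1/2) one has h' = - h^3 f' / 2, an expression in h itself and f', so the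
  induction closes without treating the root and the reciprocal separately.\<close>

lemma C_k_on_inverse_sqrt:
  fixes f :: "'a::real_normed_vector \<Rightarrow> real"
  assumes "open U" "\<And>x. x \<in> U \<Longrightarrow> f x > 0" "C_k_on k U f"
  shows "C_k_on k U (\<lambda>x. inverse (sqrt (f x)))"
  using assms(3)
proof (induction k)
  case 0
  then show ?case using assms(2)
    by (fastforce intro!: continuous_on_inverse continuous_on_real_sqrt)
next
  case (Suc k)
  let ?h = "\<lambda>x. inverse (sqrt (f x))"
  have h: "C_k_on k U ?h" using Suc.IH Suc.prems C_k_on_mono by auto
  show ?case
  proof (rule C_k_on_Suc_derivI[OF assms(1)])
    show "(?h has_derivative
        (\<lambda>v. -1/2 * (?h x * (?h x * (?h x * frechet_derivative f (at x) v))))) (at x)"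
      if "x \<in> U" for x
    proof -
      have pos: "f x > 0" using assms(2) that .
      have "((\<lambda>t. inverse (sqrt t)) has_real_derivative -1/2 * (?h x * (?h x * ?h x))) (at (f x))"
        using DERIV_inverse_fun[OF DERIV_real_sqrt[OF pos]] pos
        by (simp add: field_simps power2_eq_square)
      from diff_chain_at[OF C_k_on_Suc_derivD[OF Suc.prems that]
          has_field_derivative_imp_has_derivative[OF this]]
      show ?thesis by (simp add: o_def mult.assoc)
    qed
    show "C_k_on k U (\<lambda>x. -1/2 * (?h x * (?h x * (?h x * frechet_derivative f (at x) v))))" for v
      by (intro C_k_on_mult[OF assms(1)] C_k_on_const h) (use Suc.prems in simp)
  qed
qed

lemma smooth_on_const: "smooth_on U (\<lambda>x. a)"
  by (simp add: smooth_on_def C_k_on_const)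

lemma smooth_on_linear: "open U \<Longrightarrow> bounded_linear T \<Longrightarrow> smooth_on U T"
  by (simp add: smooth_on_def C_k_on_linear)

lemma smooth_on_add:
  "open U \<Longrightarrow> smooth_on U f \<Longrightarrow> smooth_on U g \<Longrightarrow> smooth_on U (\<lambda>x. f x + g x)"
  by (simp add: smooth_on_def C_k_on_add)

lemma smooth_on_mult:
  fixes f g :: "'a::real_normed_vector \<Rightarrow> real"
  shows "open U \<Longrightarrow> smooth_on U f \<Longrightarrow> smooth_on U g \<Longrightarrow> smooth_on U (\<lambda>x. f x * g x)"
  by (simp add: smooth_on_def C_k_on_mult)

lemma smooth_on_bounded_linear_compose:
  "open U \<Longrightarrow> bounded_linear T \<Longrightarrow> smooth_on U f \<Longrightarrow> smooth_on U (\<lambda>x. T (f x))"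
  by (simp add: smooth_on_def C_k_on_bounded_linear_compose)

lemma smooth_on_uminus: "open U \<Longrightarrow> smooth_on U f \<Longrightarrow> smooth_on U (\<lambda>x. - f x)"
  using smooth_on_bounded_linear_compose[of U uminus f] bounded_linear_minus[OF bounded_linear_ident] by simp

lemma smooth_on_diff:
  "open U \<Longrightarrow> smooth_on U f \<Longrightarrow> smooth_on U g \<Longrightarrow> smooth_on U (\<lambda>x. f x - g x)"
  using smooth_on_add[of U f "\<lambda>x. - g x"] smooth_on_uminus[of U g] by simp

lemma smooth_on_inverse_sqrt:
  fixes f :: "'a::real_normed_vector \<Rightarrow> real"
  shows "open U \<Longrightarrow> (\<And>x. x \<in> U \<Longrightarrow> f x > 0) \<Longrightarrow> smooth_on U f \<Longrightarrow>
    smooth_on U (\<lambda>x. inverse (sqrt (f x)))"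
  by (simp add: smooth_on_def C_k_on_inverse_sqrt)

lemma smooth_on_cong:
  "open U \<Longrightarrow> (\<And>x. x \<in> U \<Longrightarrow> f x = g x) \<Longrightarrow> smooth_on U f \<Longrightarrow> smooth_on U g"
  using C_k_on_cong unfolding smooth_on_def by blast

lemma smooth_on_sum:
  assumes "open U" "\<And>i. i \<in> S \<Longrightarrow> smooth_on U (f i)"
  shows "smooth_on U (\<lambda>x. \<Sum>i\<in>S. f i x)"
proof (cases "finite S")
  case True
  then show ?thesis using assms(2)
    by (induction S) (auto intro: smooth_on_const smooth_on_add[OF assms(1)])
qed (simp add: smooth_on_const)

lemma smooth_on_frame:
  fixes f :: "'a::real_normed_vector \<Rightarrow> 'b::real_normed_vector" and E :: "'i \<Rightarrow> 'b"
  assumes "finite_frame S c E" "open U" "\<And>i. i \<in> S \<Longrightarrow> smooth_on U (\<lambda>y. c i (f y))"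
  shows "smooth_on U f"
proof -
  have "smooth_on U (\<lambda>y. \<Sum>i\<in>S. c i (f y) *\<^sub>R E i)"
    by (intro smooth_on_sum assms smooth_on_bounded_linear_compose[OF assms(2) bounded_linear_scaleR_left])
  then show ?thesis using assms(1) by (simp add: finite_frame_def)
qed

lemma smooth_on_has_derivative:
  "smooth_on U f \<Longrightarrow> x \<in> U \<Longrightarrow> (f has_derivative frechet_derivative f (at x)) (at x)"
  unfolding smooth_on_def using C_k_on_Suc_derivD by blast

text \<open>The second difference is symmetric in \<open>u\<close> and \<open>v\<close>, so its limit identifies the two mixed derivatives.\<close>

lemma second_difference_limit:
  fixes f :: "'a::real_normed_vector \<Rightarrow> real"
  assumes U: "open U" "x \<in> U"
    and f: "\<And>y. y \<in> U \<Longrightarrow> (f has_derivative D y) (at y)"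
    and D: "((\<lambda>y. D y v) has_derivative D2) (at x)"
  shows "((\<lambda>t. (f (x + t *\<^sub>R u + t *\<^sub>R v) - f (x + t *\<^sub>R u) - f (x + t *\<^sub>R v) + f x) / t\<^sup>2)
           \<longlongrightarrow> D2 u) (at_right 0)"
proof (rule tendstoI)
  fix e :: real assume e: "e > 0"
  define M where "M = norm u + norm v + 1"
  have M: "M > 0" "norm u \<le> M" "norm v \<le> M" "norm u + norm v \<le> M"
    by (auto simp: M_def add_pos_nonneg add_nonneg_pos)
  interpret D2: bounded_linear D2 using D by (rule has_derivative_bounded_linear)
  \<comment> \<open>Two errors of size at most \<open>e' * (t * M)\<close> will occur; together they
    make \<open>t * (e / 2)\<close>, which leaves a strict inequality after division by t.\<close>
  define e' where "e' = e / (4 * M)"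
  have e': "e' > 0" using e M by (simp add: e'_def)
  obtain d1 where d1: "d1 > 0"
    "\<And>y. norm (y - x) < d1 \<Longrightarrow> norm (D y v - D x v - D2 (y - x)) \<le> e' * norm (y - x)"
    using D e' unfolding has_derivative_at_alt by blast
  obtain d2 where d2: "d2 > 0" "ball x d2 \<subseteq> U" using U open_contains_ball by blast
  define d where "d = min d1 d2 / M"
  have d: "d > 0" using d1 d2 M by (simp add: d_def)
  have small: "norm (r *\<^sub>R u + s *\<^sub>R v) \<le> t * M \<and> norm (r *\<^sub>R u + s *\<^sub>R v) < d1 \<and>
      norm (r *\<^sub>R u + s *\<^sub>R v) < d2"
    if "0 \<le> r" "r \<le> t" "0 \<le> s" "s \<le> t" "t < d" for r s t
  proof -
    have "norm (r *\<^sub>R u + s *\<^sub>R v) \<le> r * norm u + s * norm v"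
      using norm_triangle_ineq[of "r *\<^sub>R u" "s *\<^sub>R v"] that by simp
    also have "\<dots> \<le> t * norm u + t * norm v"
      using that by (intro add_mono mult_right_mono) auto
    also have "\<dots> = t * (norm u + norm v)" by (simp add: algebra_simps)
    also have "\<dots> \<le> t * M" using M that by (intro mult_left_mono) auto
    finally have 1: "norm (r *\<^sub>R u + s *\<^sub>R v) \<le> t * M" .
    have "t * M < d * M" using that M by (intro mult_strict_right_mono) auto
    also have "\<dots> = min d1 d2" using M by (simp add: d_def)
    finally show ?thesis using 1 by auto
  qed
  have "dist ((f (x + t *\<^sub>R u + t *\<^sub>R v) - f (x + t *\<^sub>R u) - f (x + t *\<^sub>R v) + f x) / t\<^sup>2) (D2 u) < e"
    if t: "0 < t" "t < d" for t
  proof -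
    \<comment> \<open>The second difference is \<open>\<phi> t - \<phi> 0\<close>. The mean value
      theorem in s needs only first derivatives near x, and the resulting difference of derivatives
      in direction v is compared with \<open>D2\<close> at x alone.\<close>
    define \<phi> where "\<phi> s = f (x + t *\<^sub>R u + s *\<^sub>R v) - f (x + s *\<^sub>R v)" for s
    have in_U: "x + r *\<^sub>R u + s *\<^sub>R v \<in> U" if "0 \<le> r" "r \<le> t" "0 \<le> s" "s \<le> t" for r s
      using d2 small[OF that t(2)] by (auto simp: subset_iff dist_norm algebra_simps norm_minus_commute
          dest!: spec[of _ "x + (r *\<^sub>R u + s *\<^sub>R v)"])
    have der: "(f \<circ> (\<lambda>s. x + r *\<^sub>R u + s *\<^sub>R v) has_derivative
        (D (x + r *\<^sub>R u + s *\<^sub>R v) \<circ> (\<lambda>h. h *\<^sub>R v))) (at s)"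
      if "0 \<le> r" "r \<le> t" "0 \<le> s" "s \<le> t" for r s
      by (rule diff_chain_at) (auto intro!: derivative_eq_intros f in_U that)
    have sc: "D y (h *\<^sub>R v) = h * D y v" if "y \<in> U" for y h
      using linear_scale[OF bounded_linear.linear[OF has_derivative_bounded_linear[OF f[OF that]]]] by simp
    have "\<exists>s\<in>{0<..<t}. \<phi> t - \<phi> 0 =
        (\<lambda>h. h * (D (x + t *\<^sub>R u + s *\<^sub>R v) v - D (x + s *\<^sub>R v) v)) (t - 0)"
    proof (rule mvt_simple)
      show "0 < t" by fact
      fix s assume s: "0 \<le> s" "s \<le> t"
      have "(\<phi> has_derivative (\<lambda>h. D (x + t *\<^sub>R u + s *\<^sub>R v) (h *\<^sub>R v) - D (x + s *\<^sub>R v) (h *\<^sub>R v))) (at s)"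
        unfolding \<phi>_def
        using has_derivative_diff[OF der[of t s] der[of 0 s]] s t by (simp add: o_def)
      moreover have "D (x + t *\<^sub>R u + s *\<^sub>R v) (h *\<^sub>R v) - D (x + s *\<^sub>R v) (h *\<^sub>R v)
          = h * (D (x + t *\<^sub>R u + s *\<^sub>R v) v - D (x + s *\<^sub>R v) v)" for h
        using sc[OF in_U[of t s]] sc[OF in_U[of 0 s]] s t by (simp add: algebra_simps)
      ultimately show "(\<phi> has_derivative (\<lambda>h. h * (D (x + t *\<^sub>R u + s *\<^sub>R v) v - D (x + s *\<^sub>R v) v)))
          (at s within {0..t})"
        by (simp add: has_derivative_at_withinI)
    qed
    then obtain s where s: "0 < s" "s < t"
      and eq: "\<phi> t - \<phi> 0 = t * (D (x + t *\<^sub>R u + s *\<^sub>R v) v - D (x + s *\<^sub>R v) v)" by auto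
    have a1: "\<bar>D (x + t *\<^sub>R u + s *\<^sub>R v) v - D x v - D2 (t *\<^sub>R u + s *\<^sub>R v)\<bar> \<le> e' * (t * M)"
      using d1(2)[of "x + t *\<^sub>R u + s *\<^sub>R v"] small[of t t s] s t e'
      by (simp add: add.assoc) (meson less_eq_real_def mult_left_mono order_trans)
    have a2: "\<bar>D (x + s *\<^sub>R v) v - D x v - D2 (s *\<^sub>R v)\<bar> \<le> e' * (t * M)"
      using d1(2)[of "x + s *\<^sub>R v"] small[of 0 t s] s t e'
      by simp (meson less_eq_real_def mult_left_mono order_trans)
    have "\<bar>(D (x + t *\<^sub>R u + s *\<^sub>R v) v - D (x + s *\<^sub>R v) v) - t * D2 u\<bar> \<le> 2 * (e' * (t * M))"
      using a1 a2 by (simp add: D2.add D2.scaleR)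
    also have "\<dots> = t * (e / 2)" using M by (simp add: e'_def)
    finally have b: "\<bar>(D (x + t *\<^sub>R u + s *\<^sub>R v) v - D (x + s *\<^sub>R v) v) - t * D2 u\<bar> \<le> t * (e / 2)" .
    have "(f (x + t *\<^sub>R u + t *\<^sub>R v) - f (x + t *\<^sub>R u) - f (x + t *\<^sub>R v) + f x) / t\<^sup>2 - D2 u
        = (\<phi> t - \<phi> 0) / t\<^sup>2 - D2 u" by (simp add: \<phi>_def)
    also have "\<dots> = ((D (x + t *\<^sub>R u + s *\<^sub>R v) v - D (x + s *\<^sub>R v) v) - t * D2 u) / t"
      unfolding eq using t by (simp add: field_simps power2_eq_square)
    also have "\<bar>\<dots>\<bar> \<le> e / 2" using b t by (simp add: divide_le_eq abs_divide mult.commute)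
    finally show ?thesis using e by (simp add: dist_real_def)
  qed
  then show "\<forall>\<^sub>F t in at_right 0. dist ((f (x + t *\<^sub>R u + t *\<^sub>R v) - f (x + t *\<^sub>R u) - f (x + t *\<^sub>R v) + f x) / t\<^sup>2)
      (D2 u) < e"
    unfolding eventually_at_right_field using d by (metis)
qed

lemma second_derivative_symmetric:
  fixes f :: "'a::real_normed_vector \<Rightarrow> real"
  assumes "open U" "x \<in> U" "\<And>y. y \<in> U \<Longrightarrow> (f has_derivative D y) (at y)"
    and "((\<lambda>y. D y u) has_derivative Du) (at x)" "((\<lambda>y. D y v) has_derivative Dv) (at x)"
  shows "Du v = Dv u"
proof -
  have "f (x + t *\<^sub>R u + t *\<^sub>R v) - f (x + t *\<^sub>R u) - f (x + t *\<^sub>R v) + f x =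
      f (x + t *\<^sub>R v + t *\<^sub>R u) - f (x + t *\<^sub>R v) - f (x + t *\<^sub>R u) + f x" for t
    by (simp add: ac_simps)
  then show ?thesis
    using second_difference_limit[OF assms(1-3,5), of u] second_difference_limit[OF assms(1-4), of v]
    using tendsto_unique[OF trivial_limit_at_right_real] by (metis (no_types, lifting) ext)
qed

text \<open>The mean value argument is scalar, so symmetry is obtained for every coordinate and
  reassembled by the frame.\<close>

lemma second_derivative_symmetric_frame:
  fixes F :: "'a::real_normed_vector \<Rightarrow> 'b::real_normed_vector" and E :: "'i \<Rightarrow> 'b"
  assumes fr: "finite_frame S c E"
    and "open U" "x \<in> U" "\<And>y. y \<in> U \<Longrightarrow> (F has_derivative D y) (at y)"
    and "((\<lambda>y. D y u) has_derivative Du) (at x)" "((\<lambda>y. D y v) has_derivative Dv) (at x)"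
  shows "Du v = Dv u"
proof -
  have c: "bounded_linear (c i)" for i using fr by (simp add: finite_frame_def)
  have "c i (Du v) = c i (Dv u)" for i
    by (rule second_derivative_symmetric[OF assms(2,3), of "\<lambda>y. c i (F y)" "\<lambda>y w. c i (D y w)"])
      (intro bounded_linear.has_derivative[OF c] assms; assumption)+
  then have "(\<Sum>i\<in>S. c i (Du v) *\<^sub>R E i) = (\<Sum>i\<in>S. c i (Dv u) *\<^sub>R E i)" by simp
  then show ?thesis using fr by (simp add: finite_frame_def)
qed

text \<open>If \<open>J = DF\<close> and \<open>J\<^sup>2 = - 1\<close>, then \<open>N(X, Y)\<close> reduces to
  \<open>D\<^sup>2F(JX, Y) - D\<^sup>2F(JY, X) + J D\<^sup>2F(Y, X) - J D\<^sup>2F(X, Y)\<close>, and differentiating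
  \<open>J\<^sup>2 = - 1\<close> gives \<open>D\<^sup>2F(u, J v) = - J D\<^sup>2F(u, v)\<close>.\<close>

lemma nijenhuis_derivative_eq_0:
  fixes J :: "'a::real_normed_vector \<Rightarrow> 'a \<Rightarrow> 'a" and E :: "'i \<Rightarrow> 'a"
  assumes fr: "finite_frame S c E"
    and U: "open U" "x \<in> U"
    and J: "almost_complex_structure_on U J"
    and F: "\<And>y. y \<in> U \<Longrightarrow> (F has_derivative J y) (at y)"
    and X: "smooth_on U X" and Y: "smooth_on U Y"
  shows "nijenhuis J X Y x = 0"
proof -
  have lin: "linear (J y)" and sq: "J y (J y v) = - v" if "y \<in> U" for y v
    using J that by (auto simp: almost_complex_structure_on_def)
  define DJ where "DJ u v = frechet_derivative (\<lambda>y. J y v) (at x) u" for u v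
  have DJ: "((\<lambda>y. J y v) has_derivative (\<lambda>u. DJ u v)) (at x)" for v
    unfolding DJ_def using J U(2) smooth_on_has_derivative
    by (fastforce simp: almost_complex_structure_on_def)
  have sym: "DJ u v = DJ v u" for u v
    by (rule second_derivative_symmetric_frame[OF fr U F DJ DJ])
  have anti: "DJ u (J x v) = - J x (DJ u v)" for u v
  proof -
    have "((\<lambda>y. J y (J y v)) has_derivative (\<lambda>u. DJ u (J x v) + J x (DJ u v))) (at x)"
      by (rule has_derivative_apply_linear[OF fr U lin DJ DJ])
    moreover have "((\<lambda>y. J y (J y v)) has_derivative (\<lambda>u. 0)) (at x)"
      by (rule has_derivative_transform_within_open[OF has_derivative_const[of "- v"] U]) (simp add: sq)
    ultimately have "(\<lambda>u. DJ u (J x v) + J x (DJ u v)) = (\<lambda>u. 0)" by (rule has_derivative_unique)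
    then have "DJ u (J x v) + J x (DJ u v) = 0" by (rule fun_cong)
    then show ?thesis by (simp add: eq_neg_iff_add_eq_0)
  qed
  define DX where "DX = frechet_derivative X (at x)"
  define DY where "DY = frechet_derivative Y (at x)"
  have DX: "(X has_derivative DX) (at x)" and DY: "(Y has_derivative DY) (at x)"
    using smooth_on_has_derivative X Y U(2) by (auto simp: DX_def DY_def)
  have JX: "frechet_derivative (\<lambda>y. J y (X y)) (at x) = (\<lambda>u. DJ u (X x) + J x (DX u))"
    by (rule frechet_derivative_at[OF has_derivative_apply_linear[OF fr U lin DJ DX], symmetric])
  have JY: "frechet_derivative (\<lambda>y. J y (Y y)) (at x) = (\<lambda>u. DJ u (Y x) + J x (DY u))"
    by (rule frechet_derivative_at[OF has_derivative_apply_linear[OF fr U lin DJ DY], symmetric])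
  note l = linear_add[OF lin[OF U(2)]] linear_diff[OF lin[OF U(2)]] linear_neg[OF lin[OF U(2)]]
  \<comment> \<open>Symmetry moves the vector J X from the direction of differentiation into the
    argument, where \<open>anti\<close> applies.\<close>
  have s1: "DJ (J x (X x)) (Y x) = - J x (DJ (Y x) (X x))"
    by (subst sym) (rule anti)
  have s2: "DJ (J x (Y x)) (X x) = - J x (DJ (X x) (Y x))"
    by (subst sym) (rule anti)
  show ?thesis
    unfolding nijenhuis_def lie_bracket_def JX JY DX_def[symmetric] DY_def[symmetric]
    by (simp add: l s1 s2 sq U(2))
qed

section \<open>Forms\<close>

lift_definition det_form :: "'v::euclidean_space \<Rightarrow> 'v \<Rightarrow> 'v \<Rightarrow> 'v form3" is
  "\<lambda>a b c vs. case vs of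
     [u, v, w] \<Rightarrow> (u \<bullet> a) * (v \<bullet> b) * (w \<bullet> c) + (u \<bullet> b) * (v \<bullet> c) * (w \<bullet> a)
       + (u \<bullet> c) * (v \<bullet> a) * (w \<bullet> b) - (u \<bullet> b) * (v \<bullet> a) * (w \<bullet> c)
       - (u \<bullet> c) * (v \<bullet> b) * (w \<bullet> a) - (u \<bullet> a) * (v \<bullet> c) * (w \<bullet> b)
   | _ \<Rightarrow> 0"
  unfolding is_form3_iff
  by (auto simp: linear_iff inner_simps algebra_simps split: list.splits)

text \<open>Writes a value of a form as a finite sum of products of scalars; boundedness, the
  product rule and smoothness of evaluations are all read off from it.\<close>

lemma form3_expand:
  fixes \<zeta> :: "'v::euclidean_space form3"
  shows "form3_apply \<zeta> [u, v, w] =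
    (\<Sum>a\<in>Basis. \<Sum>b\<in>Basis. \<Sum>c\<in>Basis. (u \<bullet> a) * (v \<bullet> b) * (w \<bullet> c) * form3_apply \<zeta> [a, b, c])"
proof -
  have 1: "form3_apply \<zeta> [u, v, w] = (\<Sum>a\<in>Basis. (u \<bullet> a) * form3_apply \<zeta> [a, v, w])" for u v w
    using linear_sum[OF form3_linear(1)[of \<zeta> v w], of "\<lambda>a. (u \<bullet> a) *\<^sub>R a" Basis]
    by (simp add: euclidean_representation linear_scale[OF form3_linear(1)])
  have 2: "form3_apply \<zeta> [u, v, w] = (\<Sum>b\<in>Basis. (v \<bullet> b) * form3_apply \<zeta> [u, b, w])" for u v w
    using linear_sum[OF form3_linear(2)[of \<zeta> u w], of "\<lambda>a. (v \<bullet> a) *\<^sub>R a" Basis]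
    by (simp add: euclidean_representation linear_scale[OF form3_linear(2)])
  have 3: "form3_apply \<zeta> [u, v, w] = (\<Sum>c\<in>Basis. (w \<bullet> c) * form3_apply \<zeta> [u, v, c])" for u v w
    using linear_sum[OF form3_linear(3)[of \<zeta> u v], of "\<lambda>a. (w \<bullet> a) *\<^sub>R a" Basis]
    by (simp add: euclidean_representation linear_scale[OF form3_linear(3)])
  show ?thesis
    by (subst 1, subst 2, subst 3) (simp add: sum_distrib_left mult.assoc)
qed

text \<open>The bound 1 holds because the squared norm is the sum of the squares of the values on
  all triples of basis vectors, this one among them.\<close>

lemma bounded_linear_form3_apply_basis:
  fixes a b c :: "'v::euclidean_space"
  assumes "a \<in> Basis" "b \<in> Basis" "c \<in> Basis"
  shows "bounded_linear (\<lambda>\<zeta>. form3_apply \<zeta> [a, b, c])"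
proof (rule bounded_linear_intro[where K = 1])
  fix \<zeta> :: "'v form3"
  let ?f = "\<lambda>x y z. form3_apply \<zeta> [x, y, z]"
  have "(?f a b c)\<^sup>2 \<le> (\<Sum>z\<in>Basis. (?f a b z)\<^sup>2)"
    by (rule member_le_sum) (use assms in auto)
  also have "\<dots> \<le> (\<Sum>y\<in>Basis. \<Sum>z\<in>Basis. (?f a y z)\<^sup>2)"
    using member_le_sum[of b Basis "\<lambda>y. \<Sum>z\<in>Basis. (?f a y z)\<^sup>2"] assms by (simp add: sum_nonneg)
  also have "\<dots> \<le> (\<Sum>x\<in>Basis. \<Sum>y\<in>Basis. \<Sum>z\<in>Basis. (?f x y z)\<^sup>2)"
    using member_le_sum[of a Basis "\<lambda>x. \<Sum>y\<in>Basis. \<Sum>z\<in>Basis. (?f x y z)\<^sup>2"] assms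
    by (simp add: sum_nonneg)
  also have "\<dots> = (norm \<zeta>)\<^sup>2"
    unfolding power2_norm_eq_inner inner_form3_def by (simp add: power2_eq_square)
  finally show "norm (?f a b c) \<le> norm \<zeta> * 1"
    by (simp add: abs_le_square_iff[symmetric])
qed (simp_all add: plus_form3.rep_eq scaleR_form3.rep_eq)

lemma bounded_linear_form3_apply:
  fixes u v w :: "'v::euclidean_space"
  shows "bounded_linear (\<lambda>\<zeta>. form3_apply \<zeta> [u, v, w])"
  unfolding form3_expand[of _ u v w]
  by (intro bounded_linear_sum bounded_linear_const_mult bounded_linear_form3_apply_basis)

lemma form3_eqI':
  assumes "\<And>u v w. form3_apply \<zeta> [u, v, w] = form3_apply \<eta> [u, v, w]"
  shows "\<zeta> = \<eta>"
proof (rule form3_eqI)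
  fix vs :: "'a list"
  show "form3_apply \<zeta> vs = form3_apply \<eta> vs"
  proof (cases "length vs = 3")
    case True
    then show ?thesis using assms by (auto simp: numeral_3_eq_3 length_Suc_conv)
  qed (simp add: form3_length)
qed

lemma form3_apply_sum: "form3_apply (\<Sum>i\<in>I. f i) vs = (\<Sum>i\<in>I. form3_apply (f i) vs)"
  by (induction I rule: infinite_finite_induct) (simp_all add: zero_form3.rep_eq plus_form3.rep_eq)

text \<open>Indexed by all ordered triples of basis vectors rather than the increasing ones. The six
  orderings of a triple contribute equally, hence the factor 1/6.\<close>

definition form3_frame :: "'v::euclidean_space \<times> 'v \<times> 'v \<Rightarrow> 'v form3" where
  "form3_frame = (\<lambda>(a, b, c). (1/6) *\<^sub>R det_form a b c)"

definition form3_coord :: "'v::euclidean_space \<times> 'v \<times> 'v \<Rightarrow> 'v form3 \<Rightarrow> real" where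
  "form3_coord = (\<lambda>(a, b, c) \<zeta>. form3_apply \<zeta> [a, b, c])"

lemma finite_frame_form3:
  "finite_frame (Basis \<times> Basis \<times> Basis) form3_coord (form3_frame :: 'v::euclidean_space \<times> 'v \<times> 'v \<Rightarrow> 'v form3)"
  unfolding finite_frame_def
proof (intro conjI allI)
  fix \<zeta> :: "'v form3"
  show "(\<Sum>i\<in>Basis \<times> Basis \<times> Basis. form3_coord i \<zeta> *\<^sub>R form3_frame i) = \<zeta>"
  proof (rule form3_eqI')
    fix u v w :: 'v
    let ?t = "\<lambda>u v w a b c. (u \<bullet> a) * (v \<bullet> b) * (w \<bullet> c) * form3_apply \<zeta> [a, b, c]"
    let ?S = "\<lambda>f. \<Sum>a\<in>Basis. \<Sum>b\<in>Basis. \<Sum>c\<in>Basis. f a b c :: real"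
    \<comment> \<open>Each of the six terms of the determinant is the coordinate monomial of a
      permuted argument triple. By \<open>form3_expand\<close> its sum is the value of the form on
      that permutation, and the signs make all six values equal.\<close>
    have "form3_apply (\<Sum>i\<in>Basis \<times> Basis \<times> Basis. form3_coord i \<zeta> *\<^sub>R form3_frame i) [u, v, w] =
      ?S (\<lambda>a b c. (1/6) * (?t u v w a b c + ?t w u v a b c + ?t v w u a b c
        - ?t v u w a b c - ?t w v u a b c - ?t u w v a b c))"
      by (simp add: form3_apply_sum sum.cartesian_product' scaleR_form3.rep_eq
          form3_coord_def form3_frame_def det_form.rep_eq algebra_simps
          add_divide_distrib diff_divide_distrib)
    also have "\<dots> = (1/6) * (?S (?t u v w) + ?S (?t w u v) + ?S (?t v w u)
        - ?S (?t v u w) - ?S (?t w v u) - ?S (?t u w v))"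
      by (simp only: sum.distrib sum_subtractf sum_distrib_left[symmetric])
    also have "\<dots> = form3_apply \<zeta> [u, v, w]"
      unfolding form3_expand[symmetric]
      using form3_swap(1)[of \<zeta> w u v] form3_swap(1)[of \<zeta> v w u] form3_swap(1)[of \<zeta> v u w]
        form3_swap(2)[of \<zeta> u w v] form3_swap(3)[of \<zeta> w v u] form3_swap(3)[of \<zeta> v w u]
        form3_swap(3)[of \<zeta> w u v]
      by simp
    finally show "form3_apply (\<Sum>i\<in>Basis \<times> Basis \<times> Basis. form3_coord i \<zeta> *\<^sub>R form3_frame i) [u, v, w]
        = form3_apply \<zeta> [u, v, w]" .
  qed
qed (auto simp: form3_coord_def intro: bounded_linear_form3_apply split: prod.splits)

section \<open>Vanishing criteria for k-forms\<close>

lemma form_not_distinct: "is_form k \<eta> \<Longrightarrow> \<not> distinct vs \<Longrightarrow> \<eta> vs = 0"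
  unfolding is_form_def distinct_conv_nth by (metis nat_neq_iff)

lemma form_swap:
  assumes \<eta>: "is_form k \<eta>" and vs: "length vs = k" "i < k" "j < k" "i \<noteq> j"
  shows "\<eta> (vs[i := vs ! j, j := vs ! i]) = - \<eta> vs"
proof -
  define g where "g x y = \<eta> (vs[i := x, j := y])" for x y
  have lin1: "linear (\<lambda>x. g x y)" for y
  proof -
    have "linear (\<lambda>x. \<eta> (vs[j := y, i := x]))" using \<eta> vs by (auto simp: is_form_def)
    then show ?thesis using vs by (simp add: g_def list_update_swap)
  qed
  have lin2: "linear (g x)" for x
    unfolding g_def using \<eta> vs by (auto simp: is_form_def)
  have alt: "g x x = 0" for x
  proof (cases "i < j")
    case True
    have "vs[i := x, j := x] ! i = vs[i := x, j := x] ! j" using vs by simp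
    then show ?thesis using \<eta> vs True unfolding g_def is_form_def
      by (metis length_list_update)
  next
    case False
    then have "j < i" using vs by simp
    moreover have "vs[i := x, j := x] ! j = vs[i := x, j := x] ! i" using vs by simp
    ultimately show ?thesis using \<eta> vs unfolding g_def is_form_def
      by (metis length_list_update)
  qed
  have "g (x + y) (x + y) = g x x + g x y + (g y x + g y y)" for x y
    by (simp add: linear_add[OF lin1] linear_add[OF lin2])
  then have "g x y + g y x = 0" for x y by (simp add: alt)
  from this[of "vs ! i" "vs ! j"] show ?thesis by (simp add: g_def)
qed

text \<open>A reordering changes a value only by a sign. Following just the vanishing along
  transpositions avoids computing that sign.\<close>

lemma form_mset_eq_0:
  assumes \<eta>: "is_form k \<eta>" and "mset vs = mset ws" "\<eta> ws = 0"
  shows "\<eta> vs = 0"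
proof (cases "length ws = k")
  case True
  obtain p where p: "p permutes {..<length ws}" "permute_list p ws = vs"
    using mset_eq_permutation[OF assms(2)] .
  have "\<eta> (permute_list p ws) = 0"
    using finite_lessThan p(1)
  proof (induction rule: permutes_rev_induct)
    case id
    then show ?case using assms(3) by simp
  next
    case (swap a b p)
    have *: "permute_list (p \<circ> Transposition.transpose a b) ws =
        (permute_list p ws)[a := permute_list p ws ! b, b := permute_list p ws ! a]"
      using swap by (intro nth_equalityI)
        (auto simp: permute_list_def nth_list_update transpose_def)
    show ?case unfolding * using form_swap[OF \<eta>, of "permute_list p ws" a b] swap True by simp
  qed
  then show ?thesis using p by simp
next
  case False
  then show ?thesis using \<eta> assms(2) mset_eq_length[OF assms(2)] by (simp add: is_form_def)
qed

text \<open>Multilinearity frees one slot after another: after n steps the first n entries are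
  arbitrary and only the remaining ones still lie in \<open>B\<close>. Lists with a repetition
  vanish by alternation.\<close>

lemma form_eq_0I:
  fixes \<eta> :: "'v::real_vector list \<Rightarrow> real"
  assumes \<eta>: "is_form k \<eta>" and B: "span B = UNIV"
    and 0: "\<And>vs. set vs \<subseteq> B \<Longrightarrow> distinct vs \<Longrightarrow> length vs = k \<Longrightarrow> \<eta> vs = 0"
  shows "\<eta> vs = 0"
proof (cases "length vs = k")
  case True
  have "\<forall>vs. length vs = k \<longrightarrow> set (drop n vs) \<subseteq> B \<longrightarrow> \<eta> vs = 0" if "n \<le> k" for n
    using that
  proof (induction n)
    case 0
    then show ?case using assms(3) form_not_distinct[OF \<eta>] by auto
  next
    case (Suc n)
    show ?case
    proof (intro allI impI)
      fix vs :: "'v list" assume vs: "length vs = k" "set (drop (Suc n) vs) \<subseteq> B"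
      have "linear (\<lambda>x. \<eta> (vs[n := x]))" using \<eta> vs Suc.prems by (simp add: is_form_def)
      moreover have "\<eta> (vs[n := x]) = 0" if "x \<in> B" for x
      proof -
        have "drop n (vs[n := x]) = x # drop (Suc n) vs"
          using vs Suc.prems by (simp add: drop_update_swap Cons_nth_drop_Suc[symmetric])
        then show ?thesis using Suc vs that by simp
      qed
      ultimately have "\<eta> (vs[n := x]) = 0" for x
        using linear_eq_0_on_span[of "\<lambda>x. \<eta> (vs[n := x])" B x] B by auto
      from this[of "vs ! n"] show "\<eta> vs = 0" by simp
    qed
  qed
  from this[of k] show ?thesis using True by simp
next
  case False
  then show ?thesis using \<eta> by (simp add: is_form_def)
qed

section \<open>Explicit formulas for wedge products\<close>

text \<open>Every permutation of \<open>insert a S\<close> is uniquely a transposition of a with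
  some b, or the identity, composed with a permutation of S. As a rewrite rule this recursion
  unfolds a signed sum over a concrete finite set into explicit terms.\<close>

lemma sum_sign_permutes_insert:
  fixes h :: "('a \<Rightarrow> 'a) \<Rightarrow> real"
  assumes "finite S" "a \<notin> S"
  shows "(\<Sum>\<sigma> | \<sigma> permutes insert a S. of_int (sign \<sigma>) * h \<sigma>) =
    (\<Sum>\<sigma> | \<sigma> permutes S. of_int (sign \<sigma>) * h \<sigma>)
    - (\<Sum>b\<in>S. \<Sum>\<sigma> | \<sigma> permutes S. of_int (sign \<sigma>) * h (Transposition.transpose a b \<circ> \<sigma>))"
proof -
  have "sign (Transposition.transpose a b \<circ> \<sigma>) = - sign \<sigma>" if "b \<in> S" "\<sigma> permutes S" for b \<sigma>
  proof -
    have "permutation \<sigma>" using that assms permutation_permutes by blast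
    moreover have "a \<noteq> b" using that assms by auto
    ultimately show ?thesis by (simp add: sign_compose permutation_swap_id sign_swap_id)
  qed
  then have "(\<Sum>b\<in>S. \<Sum>\<sigma> | \<sigma> permutes S. of_int (sign (Transposition.transpose a b \<circ> \<sigma>))
        * h (Transposition.transpose a b \<circ> \<sigma>))
    = (\<Sum>b\<in>S. \<Sum>\<sigma> | \<sigma> permutes S. - (of_int (sign \<sigma>) * h (Transposition.transpose a b \<circ> \<sigma>)))"
    by (intro sum.cong refl) simp
  then show ?thesis
    using assms by (simp add: sum_over_permutations_insert sum_negf)
qed

text \<open>Of the 120 permutations, 12 = 2! 3! give the same product for each of the 10 shuffles,
  which cancels the normalising factor of \<open>wedge\<close>.\<close>

lemma wedge_2_3_eq:
  fixes \<zeta> :: "'v::euclidean_space form3"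
  defines "f \<equiv> form3_apply \<zeta>"
  shows "wedge 2 3 (interior_prod v f) f [a, b, c, d, e] =
      f [v, a, b] * f [c, d, e] - f [v, a, c] * f [b, d, e] + f [v, a, d] * f [b, c, e]
    - f [v, a, e] * f [b, c, d] + f [v, b, c] * f [a, d, e] - f [v, b, d] * f [a, c, e]
    + f [v, b, e] * f [a, c, d] + f [v, c, d] * f [a, b, e] - f [v, c, e] * f [a, b, d]
    + f [v, d, e] * f [a, b, c]"
proof -
  have five: "{..<2 + 3::nat} = {0, 1, 2, 3, 4}" by auto
  have up: "[0..<2] = [0, 1::nat]" "[2..<2+3] = [2, 3, 4::nat]" by (simp_all add: upt_rec)
  \<comment> \<open>The swap rules are instantiated so that they rewrite only towards alphabetical
    order; in general form they would loop.\<close>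
  note swaps = form3_swap(1)[of \<zeta> b a] form3_swap(1)[of \<zeta> c a] form3_swap(1)[of \<zeta> d a]
    form3_swap(1)[of \<zeta> e a] form3_swap(1)[of \<zeta> c b] form3_swap(1)[of \<zeta> d b]
    form3_swap(1)[of \<zeta> e b] form3_swap(1)[of \<zeta> d c] form3_swap(1)[of \<zeta> e c] form3_swap(1)[of \<zeta> e d]
    form3_swap(2)[of \<zeta> _ b a] form3_swap(2)[of \<zeta> _ c a] form3_swap(2)[of \<zeta> _ d a]
    form3_swap(2)[of \<zeta> _ e a] form3_swap(2)[of \<zeta> _ c b] form3_swap(2)[of \<zeta> _ d b]
    form3_swap(2)[of \<zeta> _ e b] form3_swap(2)[of \<zeta> _ d c] form3_swap(2)[of \<zeta> _ e c] form3_swap(2)[of \<zeta> _ e d]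
  define h where "h \<sigma> = f (v # map (\<lambda>i. [a, b, c, d, e] ! \<sigma> i) [0..<2])
    * f (map (\<lambda>i. [a, b, c, d, e] ! \<sigma> i) [2..<2+3])" for \<sigma>
  have h: "h \<sigma> = f [v, [a, b, c, d, e] ! \<sigma> 0, [a, b, c, d, e] ! \<sigma> 1]
    * f [[a, b, c, d, e] ! \<sigma> 2, [a, b, c, d, e] ! \<sigma> 3, [a, b, c, d, e] ! \<sigma> 4]" for \<sigma>
    unfolding h_def up by simp
  have "wedge 2 3 (interior_prod v f) f [a, b, c, d, e] =
    (\<Sum>\<sigma> | \<sigma> permutes {..<2 + 3}. of_int (sign \<sigma>) * h \<sigma>) / (fact 2 * fact 3)"
    unfolding wedge_def interior_prod_def h_def by (simp add: mult.assoc)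
  also have "(\<Sum>\<sigma> | \<sigma> permutes {..<2 + 3}. of_int (sign \<sigma>) * h \<sigma>) = 12 * (
      f [v, a, b] * f [c, d, e] - f [v, a, c] * f [b, d, e] + f [v, a, d] * f [b, c, e]
    - f [v, a, e] * f [b, c, d] + f [v, b, c] * f [a, d, e] - f [v, b, d] * f [a, c, e]
    + f [v, b, e] * f [a, c, d] + f [v, c, d] * f [a, b, e] - f [v, c, e] * f [a, b, d]
    + f [v, d, e] * f [a, b, c])"
    unfolding five
    by (simp add: sum_sign_permutes_insert del: o_apply, simp only: h,
        simp add: Transposition.transpose_def, simp add: f_def swaps algebra_simps)
  finally show ?thesis by (simp add: fact_numeral)
qed

lemma wedge3_eq:
  "wedge3 p q r [x, y, z] =
     p x * q y * r z + p y * q z * r x + p z * q x * r y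
     - p y * q x * r z - p z * q y * r x - p x * q z * r y"
proof -
  have s: "{..<1 + 1::nat} = {0, 1}" "{..<1 + 2::nat} = {0, 1, 2}" by auto
  have up: "[0..<1] = [0::nat]" "[1..<1 + 1] = [1::nat]" "[1..<1 + 2] = [1, 2::nat]"
    by (simp_all add: upt_rec)
  have 11: "wedge 1 1 g h [x, y] = g [x] * h [y] - g [y] * h [x]" for g h and x y :: 'a
    unfolding wedge_def s up
    by (simp add: sum_sign_permutes_insert mult.assoc del: One_nat_def)
  define h where "h \<sigma> = p ([x, y, z] ! \<sigma> 0) * (q ([x, y, z] ! \<sigma> 1) * r ([x, y, z] ! \<sigma> 2)
    - q ([x, y, z] ! \<sigma> 2) * r ([x, y, z] ! \<sigma> 1))" for \<sigma> :: "nat \<Rightarrow> nat"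
  have "wedge3 p q r [x, y, z] =
      (\<Sum>\<sigma> | \<sigma> permutes {..<1 + 2}. of_int (sign \<sigma>) * h \<sigma>) / (fact 1 * fact 2)"
    unfolding wedge3_def wedge_def[of 1 2] h_def up
    by (simp add: 11 covector_form_def mult.assoc del: One_nat_def)
  also have "\<dots> = p x * q y * r z + p y * q z * r x + p z * q x * r y
     - p y * q x * r z - p z * q y * r x - p x * q z * r y"
    unfolding s
    by (simp add: sum_sign_permutes_insert del: o_apply One_nat_def)
      (simp add: h_def Transposition.transpose_def algebra_simps)
  finally show ?thesis .
qed

lift_definition omega_form :: "(nat \<Rightarrow> 'v::euclidean_space \<Rightarrow>\<^sub>L real) \<Rightarrow> 'v form3" is omega_minus
  unfolding is_form3_iff
proof (intro conjI allI impI)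
  fix \<alpha> :: "nat \<Rightarrow> 'v \<Rightarrow>\<^sub>L real" and vs :: "'v list"
  assume "length vs \<noteq> 3"
  then show "omega_minus \<alpha> vs = 0" by (simp add: omega_minus_def wedge3_def wedge_def)
qed (simp_all add: omega_minus_def wedge3_eq linear_iff blinfun.add_right blinfun.scaleR_right algebra_simps)

lift_definition pull :: "('v::euclidean_space \<Rightarrow>\<^sub>L 'v) \<Rightarrow> 'v form3 \<Rightarrow> 'v form3" is
  "\<lambda>A \<omega> vs. \<omega> (map (blinfun_apply A) vs)"
  unfolding is_form3_iff by (auto simp: linear_iff blinfun.add_right blinfun.scaleR_right)

lemma U_minus_eq: "U_minus \<alpha> = {pull A (omega_form \<alpha>) |A. bij (blinfun_apply A)}"
proof -
  have "(\<forall>vs. form3_apply \<zeta> vs = omega_minus \<alpha> (map (blinfun_apply A) vs)) \<longleftrightarrow>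
      \<zeta> = pull A (omega_form \<alpha>)" for \<zeta> and A :: "'a \<Rightarrow>\<^sub>L 'a"
    by (auto simp: pull.rep_eq omega_form.rep_eq intro: form3_eqI)
  then show ?thesis by (auto simp: U_minus_def)
qed

text \<open>Being a 5-form, the product is determined by its values on the six lists that omit one
  basis vector.\<close>

lemma is_form_wedge_2_3:
  fixes \<zeta> :: "'v::euclidean_space form3"
  shows "is_form 5 (wedge 2 3 (interior_prod v (form3_apply \<zeta>)) (form3_apply \<zeta>))"
proof -
  have five: "\<exists>a b c d e. vs = [a, b, c, d, e]" if "length vs = 5" for vs :: "'v list"
    using that by (auto simp: eval_nat_numeral length_Suc_conv)
  have less5: "i < 5 \<longleftrightarrow> i = 0 \<or> i = 1 \<or> i = 2 \<or> i = 3 \<or> i = 4" for i :: nat by auto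
  note lin = form3_linear[THEN linear_add] form3_linear[THEN linear_scale]
  show ?thesis
    unfolding is_form_def
  proof (intro conjI allI impI)
    fix vs :: "'v list" and i :: nat assume vs: "length vs = 5" and i: "i < 5"
    have upd: "[a, b, c, d, e][2 := x] = [a, b, x, d, e]" "[a, b, c, d, e][3 := x] = [a, b, c, x, e]"
      "[a, b, c, d, e][4 := x] = [a, b, c, d, x]" for a b c d e x :: 'v
      by (simp_all add: numeral_eq_Suc)
    show "linear (\<lambda>x. wedge 2 3 (interior_prod v (form3_apply \<zeta>)) (form3_apply \<zeta>) (vs[i := x]))"
      using five[OF vs] i unfolding less5
      by (auto simp: upd wedge_2_3_eq linear_iff lin algebra_simps)
  next
    fix vs :: "'v list" and i j :: nat assume vs: "length vs = 5" and ij: "i < j" "j < 5" "vs ! i = vs ! j"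
    obtain a b c d e where abc: "vs = [a, b, c, d, e]" using five[OF vs] by blast
    note swaps = form3_swap(1)[of \<zeta> b a] form3_swap(1)[of \<zeta> c a] form3_swap(1)[of \<zeta> d a]
      form3_swap(1)[of \<zeta> e a] form3_swap(1)[of \<zeta> c b] form3_swap(1)[of \<zeta> d b]
      form3_swap(1)[of \<zeta> e b] form3_swap(1)[of \<zeta> d c] form3_swap(1)[of \<zeta> e c] form3_swap(1)[of \<zeta> e d]
      form3_swap(2)[of \<zeta> _ b a] form3_swap(2)[of \<zeta> _ c a] form3_swap(2)[of \<zeta> _ d a]
      form3_swap(2)[of \<zeta> _ e a] form3_swap(2)[of \<zeta> _ c b] form3_swap(2)[of \<zeta> _ d b]
      form3_swap(2)[of \<zeta> _ e b] form3_swap(2)[of \<zeta> _ d c] form3_swap(2)[of \<zeta> _ e c] form3_swap(2)[of \<zeta> _ e d]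
    have "i < 5" using ij by simp
    then show "wedge 2 3 (interior_prod v (form3_apply \<zeta>)) (form3_apply \<zeta>) vs = 0"
      using ij unfolding abc less5
      by (auto simp: wedge_2_3_eq form3_alternating swaps)
  qed (simp add: wedge_def)
qed

section \<open>The model form\<close>

locale dual_bases =
  fixes \<alpha> :: "nat \<Rightarrow> 'v::euclidean_space \<Rightarrow>\<^sub>L real" and e :: "nat \<Rightarrow> 'v"
  assumes dual: "i \<in> {1..6} \<Longrightarrow> j \<in> {1..6} \<Longrightarrow> \<alpha> i (e j) = (if i = j then 1 else 0)"
    and sum_dual: "(\<Sum>i = 1..6. \<alpha> i v *\<^sub>R e i) = v"

lemma dual_bases_exist:
  fixes \<alpha> :: "nat \<Rightarrow> 'v::euclidean_space \<Rightarrow>\<^sub>L real"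
  assumes dim: "DIM('v) = 6" and \<alpha>: "is_dual_basis \<alpha>"
  shows "\<exists>e. dual_bases \<alpha> e"
proof -
  obtain b :: "nat \<Rightarrow> 'v" where b: "bij_betw b {1..6} Basis"
    using ex_bij_betw_nat_finite_1[OF finite_Basis] dim by metis
  \<comment> \<open>T records the \<alpha>-coordinates of v in an orthonormal basis; the dual basis
    \<open>e\<close> is the preimage of that basis.\<close>
  define T where "T v = (\<Sum>i = 1..6. \<alpha> i v *\<^sub>R b i)" for v
  have lin: "linear T"
    by (auto simp: T_def linear_iff blinfun.add_right blinfun.scaleR_right scaleR_add_left
        sum.distrib scaleR_sum_right)
  have bb: "b i \<bullet> b j = (if i = j then 1 else 0)" if "i \<in> {1..6}" "j \<in> {1..6}" for i j
  proof -
    have "b i \<in> Basis" "b j \<in> Basis" "b i = b j \<longleftrightarrow> i = j"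
      using b that by (auto simp: bij_betw_def inj_on_eq_iff)
    then show ?thesis by (simp add: inner_Basis)
  qed
  have T_inner: "T v \<bullet> b j = \<alpha> j v" if "j \<in> {1..6}" for v j
  proof -
    have "T v \<bullet> b j = (\<Sum>i = 1..6. if i = j then \<alpha> i v else 0)"
      unfolding T_def inner_sum_left using that bb by (intro sum.cong) auto
    also have "\<dots> = \<alpha> j v" using that by simp
    finally show ?thesis .
  qed
  have "v = 0" if "T v = 0" for v
  proof -
    have "(\<alpha> ` {1..6}) \<subseteq> {f. blinfun_apply f v = 0}" using T_inner[of _ v] that by auto
    moreover have "subspace {f :: 'v \<Rightarrow>\<^sub>L real. blinfun_apply f v = 0}"
      by (auto simp: subspace_def blinfun.add_left blinfun.scaleR_left)
    ultimately have "span (\<alpha> ` {1..6}) \<subseteq> {f. blinfun_apply f v = 0}" by (rule span_minimal)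
    \<comment> \<open>Since the \<alpha>'s span the dual space, a vector killed by all of them is
      killed by the inner product with itself.\<close>
    moreover have "blinfun_inner_left v \<in> span (\<alpha> ` {1..6})"
      using \<alpha> unfolding is_dual_basis_def by blast
    ultimately have "blinfun_apply (blinfun_inner_left v) v = 0" by blast
    then show "v = 0" by simp
  qed
  then have inj: "inj T" using linear_injective_0[OF lin] by blast
  then have surj: "surj T" by (rule linear_inj_imp_surj[OF lin])
  define e where "e i = inv T (b i)" for i
  have Te: "T (e i) = b i" for i using surj by (simp add: e_def surj_f_inv_f)
  have "dual_bases \<alpha> e"
  proof
    fix i j :: nat assume "i \<in> {1..6}" "j \<in> {1..6}"
    then show "\<alpha> i (e j) = (if i = j then 1 else 0)" using T_inner[of i "e j"] bb Te by auto
  next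
    fix v
    have "T (\<Sum>i = 1..6. \<alpha> i v *\<^sub>R e i) = T v"
      by (simp add: linear_sum[OF lin] linear_scale[OF lin] Te) (simp add: T_def)
    then show "(\<Sum>i = 1..6. \<alpha> i v *\<^sub>R e i) = v" using inj by (simp add: inj_eq)
  qed
  then show ?thesis by blast
qed

lemma is_form_interior_prod:
  assumes \<theta>: "is_form (Suc k) \<theta>"
  shows "is_form k (interior_prod x \<theta>)"
  unfolding is_form_def interior_prod_def
proof (intro conjI allI impI)
  fix vs :: "'a list" and i assume "length vs = k" "i < k"
  then have "linear (\<lambda>v. \<theta> ((x # vs)[Suc i := v]))"
    using \<theta> unfolding is_form_def by (metis Suc_less_eq length_Cons)
  then show "linear (\<lambda>v. \<theta> (x # vs[i := v]))" by simp
next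
  fix vs :: "'a list" and i j assume "length vs = k" "i < j" "j < k" "vs ! i = vs ! j"
  then have "\<not> distinct vs"
    by (metis nat_neq_iff nth_eq_iff_index_eq order.strict_trans)
  then have "\<not> distinct (x # vs)" by simp
  then show "\<theta> (x # vs) = 0" by (rule form_not_distinct[OF \<theta>])
qed (use \<theta> in \<open>simp add: is_form_def\<close>)

lemma is_form_diff_scale: "is_form k \<eta> \<Longrightarrow> is_form k \<theta> \<Longrightarrow> is_form k (\<lambda>vs. \<eta> vs - r * \<theta> vs)"
  by (auto simp: is_form_def linear_iff algebra_simps)

lemma is_form_pullback:
  fixes A :: "'v::real_normed_vector \<Rightarrow>\<^sub>L 'v"
  shows "is_form k \<theta> \<Longrightarrow> is_form k (\<lambda>vs. \<theta> (map A vs))"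
  by (auto simp: is_form_def linear_iff map_update blinfun.add_right blinfun.scaleR_right)

lemma linear_form_Cons:
  assumes "is_form (Suc k) \<theta>" "length ws = k"
  shows "linear (\<lambda>x. \<theta> (x # ws))"
proof -
  \<comment> \<open>\<open>undefined\<close> only fills the slot that is overwritten, because
    \<open>is_form\<close> speaks of updates of a given list.\<close>
  have "linear (\<lambda>x. \<theta> ((undefined # ws)[0 := x]))"
    using assms unfolding is_form_def by (metis length_Cons zero_less_Suc)
  then show ?thesis by simp
qed

context dual_bases
begin

text \<open>Otherwise the index \<open>1\<close> becomes \<open>Suc 0\<close>, and the table below no longer applies.\<close>

declare One_nat_def [simp del]

lemma dual_table [simp]:
  "\<alpha> 1 (e 1) = 1" "\<alpha> 1 (e 2) = 0" "\<alpha> 1 (e 3) = 0" "\<alpha> 1 (e 4) = 0" "\<alpha> 1 (e 5) = 0" "\<alpha> 1 (e 6) = 0"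
  "\<alpha> 2 (e 1) = 0" "\<alpha> 2 (e 2) = 1" "\<alpha> 2 (e 3) = 0" "\<alpha> 2 (e 4) = 0" "\<alpha> 2 (e 5) = 0" "\<alpha> 2 (e 6) = 0"
  "\<alpha> 3 (e 1) = 0" "\<alpha> 3 (e 2) = 0" "\<alpha> 3 (e 3) = 1" "\<alpha> 3 (e 4) = 0" "\<alpha> 3 (e 5) = 0" "\<alpha> 3 (e 6) = 0"
  "\<alpha> 4 (e 1) = 0" "\<alpha> 4 (e 2) = 0" "\<alpha> 4 (e 3) = 0" "\<alpha> 4 (e 4) = 1" "\<alpha> 4 (e 5) = 0" "\<alpha> 4 (e 6) = 0"
  "\<alpha> 5 (e 1) = 0" "\<alpha> 5 (e 2) = 0" "\<alpha> 5 (e 3) = 0" "\<alpha> 5 (e 4) = 0" "\<alpha> 5 (e 5) = 1" "\<alpha> 5 (e 6) = 0"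
  "\<alpha> 6 (e 1) = 0" "\<alpha> 6 (e 2) = 0" "\<alpha> 6 (e 3) = 0" "\<alpha> 6 (e 4) = 0" "\<alpha> 6 (e 5) = 0" "\<alpha> 6 (e 6) = 1"
  by (simp_all add: dual)

lemma set_1_6: "{1..6::nat} = {1, 2, 3, 4, 5, 6}"
  by auto

lemma expand:
  "v = \<alpha> 1 v *\<^sub>R e 1 + (\<alpha> 2 v *\<^sub>R e 2 + (\<alpha> 3 v *\<^sub>R e 3 + (\<alpha> 4 v *\<^sub>R e 4 + (\<alpha> 5 v *\<^sub>R e 5 + \<alpha> 6 v *\<^sub>R e 6))))"
  using sum_dual[of v] by (simp add: set_1_6)

lemma e_eq_iff: "i \<in> {1..6} \<Longrightarrow> j \<in> {1..6} \<Longrightarrow> e i = e j \<longleftrightarrow> i = j"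
  by (metis dual zero_neq_one)

lemma e_neq [simp]:
  "e 1 \<noteq> e 2" "e 1 \<noteq> e 3" "e 1 \<noteq> e 4" "e 1 \<noteq> e 5" "e 1 \<noteq> e 6" "e 2 \<noteq> e 3" "e 2 \<noteq> e 4" "e 2 \<noteq> e 5"
  "e 2 \<noteq> e 6" "e 3 \<noteq> e 4" "e 3 \<noteq> e 5" "e 3 \<noteq> e 6" "e 4 \<noteq> e 5" "e 4 \<noteq> e 6" "e 5 \<noteq> e 6"
  by (simp_all add: e_eq_iff)

declare e_neq [symmetric, simp]

lemma span_e: "span (e ` {1..6}) = UNIV"
proof -
  have "v \<in> span (e ` {1..6})" for v
    by (subst sum_dual[of v, symmetric]) (intro span_sum span_scale span_base imageI)
  then show ?thesis by auto
qed

definition es where "es = [e 1, e 2, e 3, e 4, e 5, e 6]"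

lemma es: "distinct es" "set es = e ` {1..6}" "card (e ` {1..6}) = 6" "length es = 6"
proof -
  show "distinct es" by (auto simp: es_def)
  show "set es = e ` {1..6}" by (auto simp: es_def set_1_6)
  then show "card (e ` {1..6}) = 6"
    using distinct_card[OF \<open>distinct es\<close>] by (simp add: es_def)
qed (simp add: es_def)

text \<open>Six distinct basis vectors are a reordering of \<open>es\<close>, so the 6-forms make up
  a line on which evaluation at \<open>es\<close> is a coordinate.\<close>

lemma form6_eq_0:
  assumes "is_form 6 \<eta>" "\<eta> es = 0"
  shows "\<eta> vs = 0"
proof (rule form_eq_0I[OF assms(1) span_e])
  fix vs assume vs: "set vs \<subseteq> e ` {1..6}" "distinct vs" "length vs = 6"
  then have "set vs = set es" by (metis card_subset_eq distinct_card es(2,3) finite_set)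
  then have "mset vs = mset es" using vs es(1) by (simp add: set_eq_iff_mset_eq_distinct)
  then show "\<eta> vs = 0" using form_mset_eq_0[OF assms(1)] assms(2) by blast
qed

text \<open>Five distinct basis vectors miss exactly one \<open>e i\<close>, so they are a
  reordering of \<open>es\<close> without it.\<close>

lemma form5_eq_0:
  assumes \<eta>: "is_form 5 \<eta>" and 0: "\<And>i. i \<in> {1..6} \<Longrightarrow> \<eta> (remove1 (e i) es) = 0"
  shows "\<eta> vs = 0"
proof (rule form_eq_0I[OF \<eta> span_e])
  fix vs assume vs: "set vs \<subseteq> e ` {1..6}" "distinct vs" "length vs = 5"
  have "set vs \<noteq> e ` {1..6}" using distinct_card[OF vs(2)] vs(3) es(3) by auto
  then obtain i where i: "i \<in> {1..6}" "e i \<notin> set vs" using vs(1) by blast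
  then have "set (e i # vs) \<subseteq> set es" "card (set (e i # vs)) = card (set es)"
    using vs distinct_card[of vs] es by auto
  then have "set (e i # vs) = set es" by (simp add: card_subset_eq)
  then have "mset (e i # vs) = mset es"
    using vs i es(1) by (metis distinct.simps(2) set_eq_iff_mset_eq_distinct)
  then have "mset vs = mset (remove1 (e i) es)"
    by (metis add_mset_remove_trivial mset.simps(2) mset_remove1)
  then show "\<eta> vs = 0" using form_mset_eq_0[OF \<eta>] 0[OF i(1)] by blast
qed

lemma remove1_es:
  "remove1 (e 1) es = [e 2, e 3, e 4, e 5, e 6]" "remove1 (e 2) es = [e 1, e 3, e 4, e 5, e 6]"
  "remove1 (e 3) es = [e 1, e 2, e 4, e 5, e 6]" "remove1 (e 4) es = [e 1, e 2, e 3, e 5, e 6]"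
  "remove1 (e 5) es = [e 1, e 2, e 3, e 4, e 6]" "remove1 (e 6) es = [e 1, e 2, e 3, e 4, e 5]"
  by (simp_all add: es_def)

text \<open>Only the component of x along the missing vector survives, as every other one repeats an
  entry. Moving \<open>e i\<close> past i - 1 vectors to its place produces the alternating signs.
  Contraction of a volume form thus reveals all coordinates of x.\<close>

lemma form6_coordinates:
  assumes \<theta>: "is_form 6 \<theta>"
  shows "\<theta> (x # remove1 (e 1) es) = \<alpha> 1 x * \<theta> es" "\<theta> (x # remove1 (e 2) es) = - \<alpha> 2 x * \<theta> es"
    "\<theta> (x # remove1 (e 3) es) = \<alpha> 3 x * \<theta> es" "\<theta> (x # remove1 (e 4) es) = - \<alpha> 4 x * \<theta> es"
    "\<theta> (x # remove1 (e 5) es) = \<alpha> 5 x * \<theta> es" "\<theta> (x # remove1 (e 6) es) = - \<alpha> 6 x * \<theta> es"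
proof -
  have lin: "linear (\<lambda>x. \<theta> [x, a, b, c, d, f])" for a b c d f
    using linear_form_Cons[of 5 \<theta> "[a, b, c, d, f]"] \<theta> by simp
  have ex: "\<theta> [x, a, b, c, d, f] = \<alpha> 1 x * \<theta> [e 1, a, b, c, d, f] + \<alpha> 2 x * \<theta> [e 2, a, b, c, d, f]
    + \<alpha> 3 x * \<theta> [e 3, a, b, c, d, f] + \<alpha> 4 x * \<theta> [e 4, a, b, c, d, f]
    + \<alpha> 5 x * \<theta> [e 5, a, b, c, d, f] + \<alpha> 6 x * \<theta> [e 6, a, b, c, d, f]" for a b c d f
    by (subst expand[of x]) (simp only: linear_add[OF lin] linear_scale[OF lin] real_scaleR_def add.assoc)
  have sw: "\<theta> [b, a, c, d, f, g] = - \<theta> [a, b, c, d, f, g]" "\<theta> [a, c, b, d, f, g] = - \<theta> [a, b, c, d, f, g]"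
    "\<theta> [a, b, d, c, f, g] = - \<theta> [a, b, c, d, f, g]" "\<theta> [a, b, c, f, d, g] = - \<theta> [a, b, c, d, f, g]"
    "\<theta> [a, b, c, d, g, f] = - \<theta> [a, b, c, d, f, g]" for a b c d f g
    using form_swap[OF \<theta>, of "[a, b, c, d, f, g]" 0 1] form_swap[OF \<theta>, of "[a, b, c, d, f, g]" 1 2]
      form_swap[OF \<theta>, of "[a, b, c, d, f, g]" 2 3] form_swap[OF \<theta>, of "[a, b, c, d, f, g]" 3 4]
      form_swap[OF \<theta>, of "[a, b, c, d, f, g]" 4 5]
    by (simp_all add: numeral_eq_Suc One_nat_def)
  note nd = form_not_distinct[OF \<theta>]
  show "\<theta> (x # remove1 (e 1) es) = \<alpha> 1 x * \<theta> es"
    unfolding remove1_es unfolding es_def by (subst ex) (simp add: nd)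
  show "\<theta> (x # remove1 (e 2) es) = - \<alpha> 2 x * \<theta> es"
    unfolding remove1_es unfolding es_def by (subst ex) (simp add: nd sw(1)[of "e 2" "e 1"])
  show "\<theta> (x # remove1 (e 3) es) = \<alpha> 3 x * \<theta> es"
    unfolding remove1_es unfolding es_def
    by (subst ex) (simp add: nd sw(1)[of "e 3" "e 1"] sw(2)[of "e 1" "e 3" "e 2"])
  show "\<theta> (x # remove1 (e 4) es) = - \<alpha> 4 x * \<theta> es"
    unfolding remove1_es unfolding es_def
    by (subst ex) (simp add: nd sw(1)[of "e 4" "e 1"] sw(2)[of "e 1" "e 4" "e 2"]
        sw(3)[of "e 1" "e 2" "e 4" "e 3"])
  show "\<theta> (x # remove1 (e 5) es) = \<alpha> 5 x * \<theta> es"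
    unfolding remove1_es unfolding es_def
    by (subst ex) (simp add: nd sw(1)[of "e 5" "e 1"] sw(2)[of "e 1" "e 5" "e 2"]
        sw(3)[of "e 1" "e 2" "e 5" "e 3"] sw(4)[of "e 1" "e 2" "e 3" "e 5" "e 4"])
  show "\<theta> (x # remove1 (e 6) es) = - \<alpha> 6 x * \<theta> es"
    unfolding remove1_es unfolding es_def
    by (subst ex) (simp add: nd sw(1)[of "e 6" "e 1"] sw(2)[of "e 1" "e 6" "e 2"]
        sw(3)[of "e 1" "e 2" "e 6" "e 3"] sw(4)[of "e 1" "e 2" "e 3" "e 6" "e 4"]
        sw(5)[of "e 1" "e 2" "e 3" "e 4" "e 6" "e 5"])
qed

end

lemma wedge_pull:
  fixes \<zeta> :: "'v::euclidean_space form3"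
  shows "wedge 2 3 (interior_prod v (form3_apply (pull A \<zeta>))) (form3_apply (pull A \<zeta>)) vs =
    wedge 2 3 (interior_prod (A v) (form3_apply \<zeta>)) (form3_apply \<zeta>) (map A vs)"
proof (cases "length vs = 5")
  case True
  then obtain a b c d e where "vs = [a, b, c, d, e]"
    by (auto simp: eval_nat_numeral length_Suc_conv)
  then show ?thesis by (simp add: wedge_2_3_eq) (simp add: pull.rep_eq)
qed (simp add: wedge_def)

context dual_bases
begin

section \<open>The complex structure of the model form\<close>

lemma omega_apply:
  "form3_apply (omega_form \<alpha>) [x, y, z] =
     (\<alpha> 1 x * \<alpha> 2 y * \<alpha> 3 z + \<alpha> 1 y * \<alpha> 2 z * \<alpha> 3 x + \<alpha> 1 z * \<alpha> 2 x * \<alpha> 3 y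
     - \<alpha> 1 y * \<alpha> 2 x * \<alpha> 3 z - \<alpha> 1 z * \<alpha> 2 y * \<alpha> 3 x - \<alpha> 1 x * \<alpha> 2 z * \<alpha> 3 y)
   + (\<alpha> 1 x * \<alpha> 4 y * \<alpha> 5 z + \<alpha> 1 y * \<alpha> 4 z * \<alpha> 5 x + \<alpha> 1 z * \<alpha> 4 x * \<alpha> 5 y
     - \<alpha> 1 y * \<alpha> 4 x * \<alpha> 5 z - \<alpha> 1 z * \<alpha> 4 y * \<alpha> 5 x - \<alpha> 1 x * \<alpha> 4 z * \<alpha> 5 y)
   + (\<alpha> 2 x * \<alpha> 4 y * \<alpha> 6 z + \<alpha> 2 y * \<alpha> 4 z * \<alpha> 6 x + \<alpha> 2 z * \<alpha> 4 x * \<alpha> 6 y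
     - \<alpha> 2 y * \<alpha> 4 x * \<alpha> 6 z - \<alpha> 2 z * \<alpha> 4 y * \<alpha> 6 x - \<alpha> 2 x * \<alpha> 4 z * \<alpha> 6 y)
   - (\<alpha> 3 x * \<alpha> 5 y * \<alpha> 6 z + \<alpha> 3 y * \<alpha> 5 z * \<alpha> 6 x + \<alpha> 3 z * \<alpha> 5 x * \<alpha> 6 y
     - \<alpha> 3 y * \<alpha> 5 x * \<alpha> 6 z - \<alpha> 3 z * \<alpha> 5 y * \<alpha> 6 x - \<alpha> 3 x * \<alpha> 5 z * \<alpha> 6 y)"
  by (simp add: omega_form.rep_eq omega_minus_def wedge3_eq)

text \<open>The model is the real part of (\<alpha> 1 - i \<alpha> 6) \<and> (\<alpha> 2 + i
  \<alpha> 5) \<and> (\<alpha> 3 + i \<alpha> 4), and \<open>J0\<close> is the complex structure for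
  which these three covectors are complex linear. This is why \<open>J0\<close> can be moved between
  slots in \<open>omega_J0\<close>.\<close>

definition J0 :: "'v \<Rightarrow>\<^sub>L 'v" where
  "J0 = (blinfun_scaleR_left (e 1) o\<^sub>L \<alpha> 6) - (blinfun_scaleR_left (e 2) o\<^sub>L \<alpha> 5)
      - (blinfun_scaleR_left (e 3) o\<^sub>L \<alpha> 4) + (blinfun_scaleR_left (e 4) o\<^sub>L \<alpha> 3)
      + (blinfun_scaleR_left (e 5) o\<^sub>L \<alpha> 2) - (blinfun_scaleR_left (e 6) o\<^sub>L \<alpha> 1)"

lemma J0_apply:
  "J0 v = \<alpha> 6 v *\<^sub>R e 1 - \<alpha> 5 v *\<^sub>R e 2 - \<alpha> 4 v *\<^sub>R e 3 + \<alpha> 3 v *\<^sub>R e 4 + \<alpha> 2 v *\<^sub>R e 5 - \<alpha> 1 v *\<^sub>R e 6"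
  by (simp add: J0_def blinfun.add_left blinfun.diff_left)

lemma J0_coordinates:
  "\<alpha> 1 (J0 v) = \<alpha> 6 v" "\<alpha> 2 (J0 v) = - \<alpha> 5 v" "\<alpha> 3 (J0 v) = - \<alpha> 4 v"
  "\<alpha> 4 (J0 v) = \<alpha> 3 v" "\<alpha> 5 (J0 v) = \<alpha> 2 v" "\<alpha> 6 (J0 v) = - \<alpha> 1 v"
  by (simp_all add: J0_apply blinfun.add_right blinfun.diff_right blinfun.scaleR_right)

lemma J0_J0: "J0 (J0 v) = - v"
  by (subst (2) expand[of v], subst J0_apply) (simp add: J0_coordinates)

lemma omega_J0:
  "form3_apply (omega_form \<alpha>) [J0 v, w, u] = form3_apply (omega_form \<alpha>) [v, J0 w, u]"
  by (simp add: omega_apply J0_coordinates algebra_simps)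

text \<open>A comparison of 5-forms on the six basic lists. The factor 2 is visible at v = e 1:
  contraction gives \<alpha> 2 \<and> \<alpha> 3 + \<alpha> 4 \<and> \<alpha> 5, and both summands
  contribute the same 5-form. Division by \<open>\<theta> es\<close> normalises the arbitrary volume
  form.\<close>

lemma wedge_omega:
  assumes \<theta>: "is_form 6 \<theta>" "\<theta> es \<noteq> 0"
  shows "wedge 2 3 (interior_prod v (form3_apply (omega_form \<alpha>))) (form3_apply (omega_form \<alpha>)) vs
    = 2 / \<theta> es * \<theta> (J0 v # vs)"
proof -
  define \<eta> where "\<eta> vs = wedge 2 3 (interior_prod v (form3_apply (omega_form \<alpha>))) (form3_apply (omega_form \<alpha>)) vs
    - 2 / \<theta> es * interior_prod (J0 v) \<theta> vs" for vs
  have "is_form 5 \<eta>"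
    unfolding \<eta>_def using \<theta> by (intro is_form_diff_scale is_form_wedge_2_3 is_form_interior_prod) simp
  moreover have "\<eta> (remove1 (e i) es) = 0" if "i \<in> {1..6}" for i
  proof -
    have "\<eta> (remove1 (e 1) es) = 0" "\<eta> (remove1 (e 2) es) = 0" "\<eta> (remove1 (e 3) es) = 0"
      "\<eta> (remove1 (e 4) es) = 0" "\<eta> (remove1 (e 5) es) = 0" "\<eta> (remove1 (e 6) es) = 0"
      unfolding \<eta>_def interior_prod_def[of "J0 v" \<theta>] form6_coordinates[OF \<theta>(1)] J0_coordinates
      unfolding remove1_es wedge_2_3_eq using \<theta>(2) by (simp_all add: omega_apply)
    then show ?thesis using that unfolding set_1_6 by auto
  qed
  ultimately have "\<eta> vs = 0" by (rule form5_eq_0)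
  then show ?thesis by (simp add: \<eta>_def interior_prod_def)
qed

section \<open>Existence and uniqueness of J on the orbit\<close>

lemma form6_es_nonzero:
  assumes "is_form 6 \<theta>" "\<theta> \<noteq> (\<lambda>_. 0)"
  shows "\<theta> es \<noteq> 0"
  using form6_eq_0[OF assms(1)] assms(2) by auto

lemma form6_nondegenerate:
  assumes \<theta>: "is_form 6 \<theta>" "\<theta> es \<noteq> 0" and eq: "\<And>vs. \<theta> (x # vs) = \<theta> (y # vs)"
  shows "x = y"
proof -
  have "\<alpha> i x = \<alpha> i y" if "i \<in> {1..6}" for i
    using eq[of "remove1 (e i) es"] \<theta>(2) that unfolding set_1_6
    by (auto simp: form6_coordinates[OF \<theta>(1)])
  then have "(\<Sum>i = 1..6. \<alpha> i x *\<^sub>R e i) = (\<Sum>i = 1..6. \<alpha> i y *\<^sub>R e i)" by simp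
  then show ?thesis by (simp only: sum_dual)
qed

text \<open>The scalar d is the determinant of A, obtained here from the fact that 6-forms make up a
  line.\<close>

lemma form6_pullback:
  assumes \<theta>: "is_form 6 \<theta>" "\<theta> es \<noteq> 0" and A: "bij (blinfun_apply A)"
  obtains d where "d \<noteq> 0" "\<And>vs. \<theta> (map A vs) = d * \<theta> vs"
proof -
  define d where "d = \<theta> (map A es) / \<theta> es"
  have "\<theta> (map A vs) - d * \<theta> vs = 0" for vs
    by (rule form6_eq_0[OF is_form_diff_scale[OF is_form_pullback[OF \<theta>(1)] \<theta>(1)]])
      (use \<theta>(2) in \<open>simp add: d_def\<close>)
  then have d: "\<theta> (map A vs) = d * \<theta> vs" for vs by (simp add: algebra_simps)
  have "map A (map (inv A) es) = es" using A by (simp add: bij_is_surj surj_f_inv_f o_def)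
  then have "d \<noteq> 0" using d[of "map (inv A) es"] \<theta>(2) by auto
  then show ?thesis using d that by blast
qed

text \<open>Conjugating \<open>J0\<close> by A gives a solution up to sign, since the pulled back
  identity carries the factor 2 d / \<theta>(es), which may be negative. The last conclusion,
  inherited from the model, records that zeta is the real part of a (3,0)-form.\<close>

lemma J_exists:
  assumes \<theta>: "is_form 6 \<theta>" "\<theta> es \<noteq> 0" and \<zeta>: "\<zeta> \<in> U_minus \<alpha>"
  obtains J :: "'v \<Rightarrow>\<^sub>L 'v" and a where "\<And>v. J (J v) = - v" "a > 0"
    "\<And>v. wedge 2 3 (interior_prod v (form3_apply \<zeta>)) (form3_apply \<zeta>) = interior_prod (J v) (\<lambda>vs. a * \<theta> vs)"
    "\<And>u v w. form3_apply \<zeta> [J v, w, u] = form3_apply \<zeta> [v, J w, u]"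
proof -
  obtain A where A: "bij (blinfun_apply A)" and \<zeta>A: "\<zeta> = pull A (omega_form \<alpha>)"
    using \<zeta> unfolding U_minus_eq by blast
  obtain d where d: "d \<noteq> 0" "\<And>vs. \<theta> (map A vs) = d * \<theta> vs" using form6_pullback[OF \<theta> A] by metis
  have AA: "A (inv A v) = v" for v using A by (simp add: bij_is_surj surj_f_inv_f)
  have AA': "inv A (A v) = v" for v using A by (simp add: bij_is_inj)
  have linA: "linear A" using blinfun.bounded_linear_right bounded_linear.linear by blast
  have linA': "linear (inv A)" by (rule inj_linear_imp_inv_linear[OF linA bij_is_inj[OF A]])
  \<comment> \<open>Replacing J by - J preserves J^2 = - 1 and changes the sign of the factor, so
    \<open>s\<close> makes the factor positive.\<close>
  define s where "s = sgn (2 * d / \<theta> es)"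
  have s: "s * s = 1" "2 * d / \<theta> es = \<bar>2 * d / \<theta> es\<bar> * s"
    using d \<theta> by (auto simp only: s_def abs_mult_sgn) (auto simp: sgn_real_def)
  define J where "J = Blinfun (\<lambda>v. s *\<^sub>R inv A (J0 (A v)))"
  have "linear (\<lambda>v. s *\<^sub>R inv A (J0 (A v)))"
    by (auto simp: linear_iff blinfun.add_right blinfun.scaleR_right linear_add[OF linA'] linear_scale[OF linA']
        scaleR_add_right)
  then have J: "J v = s *\<^sub>R inv A (J0 (A v))" for v
    unfolding J_def by (simp add: bounded_linear_Blinfun_apply linear_conv_bounded_linear)
  have AJ: "A (J v) = s *\<^sub>R J0 (A v)" for v by (simp add: J blinfun.scaleR_right AA)
  show ?thesis
  proof
    fix v
    have "A (J (J v)) = A (- v)" using s(1) by (simp add: AJ blinfun.scaleR_right blinfun.minus_right J0_J0)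
    then show "J (J v) = - v" by (metis AA')
  next
    show "\<bar>2 * d / \<theta> es\<bar> > 0" using d \<theta> by simp
  next
    fix v
    show "wedge 2 3 (interior_prod v (form3_apply \<zeta>)) (form3_apply \<zeta>)
        = interior_prod (J v) (\<lambda>vs. \<bar>2 * d / \<theta> es\<bar> * \<theta> vs)"
    proof
      fix vs
      have J0A: "J0 (A v) = A (s *\<^sub>R J v)" using s(1) by (simp add: blinfun.scaleR_right AJ)
      have "wedge 2 3 (interior_prod v (form3_apply \<zeta>)) (form3_apply \<zeta>) vs = 2 / \<theta> es * \<theta> (J0 (A v) # map A vs)"
        unfolding \<zeta>A wedge_pull wedge_omega[OF \<theta>] ..
      also have "\<dots> = 2 * d / \<theta> es * \<theta> ((s *\<^sub>R J v) # vs)"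
        using d(2)[of "(s *\<^sub>R J v) # vs"] by (simp add: J0A)
      also have "\<theta> ((s *\<^sub>R J v) # vs) = s * \<theta> (J v # vs)"
      proof (cases "length vs = 5")
        case True
        have "linear (\<lambda>x. \<theta> (x # vs))" by (rule linear_form_Cons[of 5]) (use \<theta> True in simp_all)
        from linear_scale[OF this] show ?thesis by simp
      qed (use \<theta> in \<open>simp add: is_form_def\<close>)
      also have "2 * d / \<theta> es * (s * \<theta> (J v # vs)) = \<bar>2 * d / \<theta> es\<bar> * (s * s) * \<theta> (J v # vs)"
        by (subst s(2)) simp
      finally show "wedge 2 3 (interior_prod v (form3_apply \<zeta>)) (form3_apply \<zeta>) vs
          = interior_prod (J v) (\<lambda>vs. \<bar>2 * d / \<theta> es\<bar> * \<theta> vs) vs"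
        by (simp add: s(1) interior_prod_def[of "J v"])
    qed
  next
    fix u v w
    note sc = form3_linear[THEN linear_scale]
    show "form3_apply \<zeta> [J v, w, u] = form3_apply \<zeta> [v, J w, u]"
      by (simp add: \<zeta>A pull.rep_eq AJ sc omega_J0)
  qed
qed

text \<open>Uniqueness: nondegeneracy of the volume form makes two solutions proportional, J' = r J
  with r = a / a' > 0, and J'^2 = J^2 = - 1 forces r = 1. The description in \<open>J_form\<close>
  therefore denotes the solution just constructed.\<close>

lemma J_form:
  assumes \<theta>: "is_form 6 \<theta>" "\<theta> es \<noteq> 0" and \<zeta>: "\<zeta> \<in> U_minus \<alpha>"
  shows J_form_sq: "J_form \<theta> \<zeta> (J_form \<theta> \<zeta> v) = - v"
    and J_form_sym: "form3_apply \<zeta> [J_form \<theta> \<zeta> v, w, u] = form3_apply \<zeta> [v, J_form \<theta> \<zeta> w, u]"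
    and J_form_wedge: "\<exists>a>0. \<forall>v. wedge 2 3 (interior_prod v (form3_apply \<zeta>)) (form3_apply \<zeta>)
                = interior_prod (J_form \<theta> \<zeta> v) (\<lambda>vs. a * \<theta> vs)"
proof -
  obtain J a where J: "\<And>v. blinfun_apply J (J v) = - v" "a > 0"
    "\<And>v. wedge 2 3 (interior_prod v (form3_apply \<zeta>)) (form3_apply \<zeta>) = interior_prod (J v) (\<lambda>vs. a * \<theta> vs)"
    "\<And>u v w. form3_apply \<zeta> [J v, w, u] = form3_apply \<zeta> [v, J w, u]"
    using J_exists[OF assms] by metis
  have "J_form \<theta> \<zeta> = J"
    unfolding J_form_def
  proof (rule the_equality)
    show "(\<forall>v. J (J v) = - v) \<and> (\<exists>a>0. \<forall>v. wedge 2 3 (interior_prod v (form3_apply \<zeta>)) (form3_apply \<zeta>)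
        = interior_prod (J v) (\<lambda>vs. a * \<theta> vs))" using J by blast
  next
    fix J' assume "(\<forall>v. blinfun_apply J' (J' v) = - v) \<and> (\<exists>a>0. \<forall>v.
        wedge 2 3 (interior_prod v (form3_apply \<zeta>)) (form3_apply \<zeta>) = interior_prod (J' v) (\<lambda>vs. a * \<theta> vs))"
    then obtain a' where J': "\<And>v. J' (J' v) = - v" "a' > 0"
      "\<And>v. wedge 2 3 (interior_prod v (form3_apply \<zeta>)) (form3_apply \<zeta>) = interior_prod (J' v) (\<lambda>vs. a' * \<theta> vs)"
      by blast
    define r where "r = a / a'"
    have r: "r > 0" using J(2) J'(2) by (simp add: r_def)
    have sc: "\<theta> ((r *\<^sub>R x) # vs) = r * \<theta> (x # vs)" for x vs
    proof (cases "length vs = 5")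
      case True
      have "linear (\<lambda>x. \<theta> (x # vs))" by (rule linear_form_Cons[of 5]) (use \<theta> True in simp_all)
      from linear_scale[OF this] show ?thesis by simp
    qed (use \<theta> in \<open>simp add: is_form_def\<close>)
    have rJ: "J' v = r *\<^sub>R J v" for v
    proof (rule form6_nondegenerate[OF \<theta>])
      fix vs
      have "a' * \<theta> (J' v # vs) = a * \<theta> (J v # vs)"
        using fun_cong[OF J(3)[of v], of vs] fun_cong[OF J'(3)[of v], of vs] by (simp add: interior_prod_def)
      then show "\<theta> (J' v # vs) = \<theta> ((r *\<^sub>R J v) # vs)"
        using J'(2) unfolding sc by (simp add: r_def field_simps)
    qed
    have "- e 1 = (r * r) *\<^sub>R (- e 1)"
      using J'(1)[of "e 1"] J(1)[of "e 1"] by (simp add: rJ blinfun.scaleR_right)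
    from arg_cong[OF this, of "\<alpha> 1"] have "r * r = 1"
      by (simp add: blinfun.scaleR_right blinfun.minus_right)
    then have "r = 1" using r by (simp add: square_eq_1_iff)
    then show "J' = J" by (intro blinfun_eqI) (simp add: rJ)
  qed
  then show "J_form \<theta> \<zeta> (J_form \<theta> \<zeta> v) = - v"
    "form3_apply \<zeta> [J_form \<theta> \<zeta> v, w, u] = form3_apply \<zeta> [v, J_form \<theta> \<zeta> w, u]"
    "\<exists>a>0. \<forall>v. wedge 2 3 (interior_prod v (form3_apply \<zeta>)) (form3_apply \<zeta>)
                = interior_prod (J_form \<theta> \<zeta> v) (\<lambda>vs. a * \<theta> vs)"
    using J by blast+
qed

end

section \<open>Openness of the orbit\<close>

lemma continuous_on_frame:
  fixes f :: "'a::real_normed_vector \<Rightarrow> 'b::real_normed_vector" and E :: "'i \<Rightarrow> 'b"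
  assumes "finite_frame S c E" "\<And>i. i \<in> S \<Longrightarrow> continuous_on U (\<lambda>y. c i (f y))"
  shows "continuous_on U f"
proof -
  have "continuous_on U (\<lambda>y. \<Sum>i\<in>S. c i (f y) *\<^sub>R E i)"
    by (intro continuous_on_sum continuous_on_scaleR continuous_on_const assms)
  then show ?thesis using assms(1) by (simp add: finite_frame_def)
qed

text \<open>The frame embeds the space linearly, as a retract, into a Euclidean space, where Sussmann's
  theorem is available.\<close>

lemma open_mapping_frame:
  fixes \<Psi> :: "'a::real_normed_vector \<Rightarrow> 'a" and E :: "'i \<Rightarrow> 'a"
    and \<beta> :: "'n::finite \<Rightarrow> 'i"
  assumes fr: "finite_frame S c E" and \<beta>: "bij_betw \<beta> UNIV S"
    and U: "open U" "x \<in> U" and cont: "continuous_on U \<Psi>"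
    and der: "(\<Psi> has_derivative (\<lambda>h. h)) (at x)"
  shows "\<Psi> x \<in> interior (\<Psi> ` U)"
proof -
  define T where "T v = (\<Sum>p\<in>UNIV. c (\<beta> p) v *\<^sub>R axis p (1::real))" for v
  define P where "P w = (\<Sum>p\<in>UNIV. (w $ p) *\<^sub>R E (\<beta> p))" for w :: "real ^ 'n"
  have c: "bounded_linear (c i)" for i using fr by (simp add: finite_frame_def)
  have T: "bounded_linear T"
    unfolding T_def by (intro bounded_linear_sum bounded_linear_scaleR_const c)
  have P: "bounded_linear P"
    unfolding P_def by (intro bounded_linear_sum bounded_linear_scaleR_const bounded_linear_vec_nth)
  interpret T: bounded_linear T by (fact T)
  interpret P: bounded_linear P by (fact P)
  have PT: "P (T v) = v" for v
  proof -
    have "T v $ q = c (\<beta> q) v" for q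
      by (simp add: T_def axis_def if_distrib cong: if_cong)
    then have "P (T v) = (\<Sum>p\<in>UNIV. c (\<beta> p) v *\<^sub>R E (\<beta> p))" by (simp add: P_def)
    also have "\<dots> = (\<Sum>i\<in>S. c i v *\<^sub>R E i)" by (rule sum.reindex_bij_betw[OF \<beta>])
    finally show ?thesis using fr by (simp add: finite_frame_def)
  qed
  \<comment> \<open>On the image of \<open>T\<close> this is \<open>\<Psi>\<close>; the added
    projection onto the kernel of \<open>P\<close> makes the derivative at \<open>T x\<close> the
    full identity.\<close>
  define f where "f w = T (\<Psi> (P w)) + (w - T (P w))" for w
  have open_PU: "open (P -` U)"
    using continuous_open_vimage[OF U(1)] linear_continuous_at[OF P] by blast
  have "f (T x) \<in> interior (f ` (P -` U))"
  proof (rule sussmann_open_mapping[OF open_PU _ _ _ _ _ subset_refl])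
    have "continuous_on (P -` U) (\<lambda>w. \<Psi> (P w))"
      by (rule continuous_on_compose2[OF cont]) (auto intro: P.continuous_on)
    then show "continuous_on (P -` U) f"
      unfolding f_def by (intro continuous_intros T.continuous_on P.continuous_on)
    show "T x \<in> P -` U" using U PT by simp
    then show "T x \<in> interior (P -` U)" using open_PU by (simp add: interior_open)
    have "((\<lambda>w. \<Psi> (P w)) has_derivative P) (at (T x))"
      using diff_chain_at[of P P "T x" \<Psi> "\<lambda>h. h"] der bounded_linear_imp_has_derivative[OF P]
      by (simp add: o_def PT)
    then have "(f has_derivative (\<lambda>h. T (P h) + (h - T (P h)))) (at (T x))"
      unfolding f_def
      by (intro has_derivative_add has_derivative_diff has_derivative_ident T.has_derivative
          bounded_linear_imp_has_derivative[OF P])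
    then show "(f has_derivative id) (at (T x))" by (simp add: id_def)
    show "bounded_linear (id :: real ^ 'n \<Rightarrow> _)" by (simp add: bounded_linear_ident id_def)
    show "id \<circ> id = (id :: real ^ 'n \<Rightarrow> _)" by simp
  qed
  then obtain W where W: "open W" "T (\<Psi> x) \<in> W" "W \<subseteq> f ` (P -` U)"
    by (auto simp: interior_def f_def PT)
  have "T -` W \<subseteq> \<Psi> ` U"
  proof
    fix \<eta> assume "\<eta> \<in> T -` W"
    then obtain w where w: "T \<eta> = f w" "P w \<in> U" using W by auto
    \<comment> \<open>\<open>P\<close> annihilates the added summand, so a preimage under
      \<open>f\<close> yields one under \<open>\<Psi>\<close>.\<close>
    from arg_cong[OF w(1), of P] have "\<eta> = \<Psi> (P w)"
      by (simp add: f_def PT P.add P.diff)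
    then show "\<eta> \<in> \<Psi> ` U" using w(2) by blast
  qed
  moreover have "open (T -` W)"
    using continuous_open_vimage[OF W(1)] linear_continuous_at[OF T] by blast
  ultimately show ?thesis using W(2) by (intro interiorI[of "T -` W"]) auto
qed

text \<open>After expansion in the basis this is the product rule for four scalar factors: the form
  and its three arguments.\<close>

lemma has_derivative_form3_apply:
  fixes \<zeta> :: "'a::real_normed_vector \<Rightarrow> 'v::euclidean_space form3"
  assumes \<zeta>: "(\<zeta> has_derivative \<zeta>') (at x)" and X: "(X has_derivative X') (at x)"
    and Y: "(Y has_derivative Y') (at x)" and Z: "(Z has_derivative Z') (at x)"
  shows "((\<lambda>y. form3_apply (\<zeta> y) [X y, Y y, Z y]) has_derivative
    (\<lambda>h. form3_apply (\<zeta>' h) [X x, Y x, Z x] + form3_apply (\<zeta> x) [X' h, Y x, Z x]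
       + form3_apply (\<zeta> x) [X x, Y' h, Z x] + form3_apply (\<zeta> x) [X x, Y x, Z' h])) (at x)"
proof -
  have \<zeta>c: "((\<lambda>y. form3_apply (\<zeta> y) [a, b, c]) has_derivative (\<lambda>h. form3_apply (\<zeta>' h) [a, b, c])) (at x)"
    for a b c by (rule bounded_linear.has_derivative[OF bounded_linear_form3_apply \<zeta>])
  note inner = bounded_linear.has_derivative[OF bounded_linear_inner_left]
  have "((\<lambda>y. \<Sum>a\<in>Basis. \<Sum>b\<in>Basis. \<Sum>c\<in>Basis.
        (X y \<bullet> a) * (Y y \<bullet> b) * (Z y \<bullet> c) * form3_apply (\<zeta> y) [a, b, c]) has_derivative
      (\<lambda>h. \<Sum>a\<in>Basis. \<Sum>b\<in>Basis. \<Sum>c\<in>Basis.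
        (X x \<bullet> a) * (Y x \<bullet> b) * (Z x \<bullet> c) * form3_apply (\<zeta>' h) [a, b, c]
        + ((X x \<bullet> a) * (Y x \<bullet> b) * (Z' h \<bullet> c) + ((X x \<bullet> a) * (Y' h \<bullet> b) + (X' h \<bullet> a) * (Y x \<bullet> b)) * (Z x \<bullet> c))
          * form3_apply (\<zeta> x) [a, b, c])) (at x)"
    by (intro has_derivative_sum has_derivative_mult inner[OF X] inner[OF Y] inner[OF Z] \<zeta>c)
  then show ?thesis
    unfolding form3_expand[symmetric]
    by (rule has_derivative_eq_rhs)
      (subst (2 3 4 5) form3_expand, simp add: fun_eq_iff sum.distrib algebra_simps form3_expand[symmetric])
qed

text \<open>The derivative, at the identity and in direction A, of the pullback of a fixed
  form.\<close>

definition pull_deriv_fun :: "('v \<Rightarrow> 'v) \<Rightarrow> ('v list \<Rightarrow> real) \<Rightarrow> 'v list \<Rightarrow> real" where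
  "pull_deriv_fun A \<omega> vs = (case vs of
     [x, y, z] \<Rightarrow> \<omega> [A x, y, z] + \<omega> [x, A y, z] + \<omega> [x, y, A z]
   | _ \<Rightarrow> 0)"

lemma is_form_pull_deriv_fun:
  fixes A :: "'v::euclidean_space \<Rightarrow> 'v"
  assumes A: "linear A" and "is_form 3 \<omega>"
  shows "is_form 3 (pull_deriv_fun A \<omega>)"
proof -
  obtain \<Omega> where \<omega>: "\<omega> = form3_apply \<Omega>"
    using assms form3_apply_cases[of \<omega>] by auto
  note lin = form3_linear[THEN linear_add] form3_linear[THEN linear_scale]
  show ?thesis
    unfolding is_form3_iff \<omega>
  proof (intro conjI allI impI)
    fix vs :: "'v list" assume "length vs \<noteq> 3"
    then show "pull_deriv_fun A (form3_apply \<Omega>) vs = 0"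
      by (auto simp: pull_deriv_fun_def split: list.split)
  next
    fix a b :: 'v
    show "pull_deriv_fun A (form3_apply \<Omega>) [a, a, b] = 0"
      using form3_swap(1)[of \<Omega> "A a" a b] by (simp add: pull_deriv_fun_def form3_alternating)
    show "pull_deriv_fun A (form3_apply \<Omega>) [a, b, a] = 0"
      using form3_swap(3)[of \<Omega> "A a" b a] by (simp add: pull_deriv_fun_def form3_alternating)
    show "pull_deriv_fun A (form3_apply \<Omega>) [b, a, a] = 0"
      using form3_swap(2)[of \<Omega> b "A a" a] by (simp add: pull_deriv_fun_def form3_alternating)
  qed (simp_all add: pull_deriv_fun_def linear_iff linear_add[OF A] linear_scale[OF A] lin algebra_simps)
qed

lift_definition pull_deriv :: "('v::euclidean_space \<Rightarrow>\<^sub>L 'v) \<Rightarrow> 'v form3 \<Rightarrow> 'v form3" is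
  "\<lambda>A. pull_deriv_fun (blinfun_apply A)"
  by (intro is_form_pull_deriv_fun blinfun.bounded_linear_right[THEN bounded_linear.linear])

lemma pull_pull: "pull A (pull B \<zeta>) = pull (B o\<^sub>L A) \<zeta>"
  by (rule form3_eqI) (simp add: pull.rep_eq blinfun_compose.rep_eq)

lemma continuous_pull: "continuous (at \<zeta>) (pull A)" for \<zeta> :: "'v::euclidean_space form3"
proof -
  have "continuous_on UNIV (pull A :: 'v form3 \<Rightarrow> _)"
  proof (rule continuous_on_frame[OF finite_frame_form3])
    fix i :: "'v \<times> 'v \<times> 'v"
    show "continuous_on UNIV (\<lambda>y. form3_coord i (pull A y))"
      by (auto simp: form3_coord_def pull.rep_eq split: prod.splits
          intro!: linear_continuous_on bounded_linear_form3_apply)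
  qed
  then show ?thesis by (simp add: continuous_on_eq_continuous_at)
qed

context dual_bases
begin

section \<open>Surjectivity of the differential of the orbit map\<close>

lemma form3_eqI_es:
  fixes \<zeta> \<eta> :: "'v form3"
  assumes "\<And>i j k. i \<in> {1..6} \<Longrightarrow> j \<in> {1..6} \<Longrightarrow> k \<in> {1..6} \<Longrightarrow> i < j \<Longrightarrow> j < k \<Longrightarrow>
    form3_apply \<zeta> [e i, e j, e k] = form3_apply \<eta> [e i, e j, e k]"
  shows "\<zeta> = \<eta>"
proof -
  have "form3_apply (\<zeta> - \<eta>) vs = 0" for vs
  proof (rule form_eq_0I[OF _ span_e])
    show "is_form 3 (form3_apply (\<zeta> - \<eta>))" using form3_apply by blast
    fix vs assume vs: "set vs \<subseteq> e ` {1..6}" "distinct vs" "length vs = 3"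
    then obtain i j k where ijk: "vs = [e i, e j, e k]" "i \<in> {1..6}" "j \<in> {1..6}" "k \<in> {1..6}"
      by (auto simp: numeral_3_eq_3 length_Suc_conv)
    then have "i \<noteq> j" "i \<noteq> k" "j \<noteq> k" using vs(2) by auto
    then consider "i < j" "j < k" | "i < k" "k < j" | "j < i" "i < k" | "j < k" "k < i" | "k < i" "i < j"
      | "k < j" "j < i" by linarith
    then have "form3_apply \<zeta> vs = form3_apply \<eta> vs"
    proof cases
      case 1 then show ?thesis using assms[of i j k] ijk by simp
    next
      case 2 then show ?thesis using assms[of i k j] ijk by (simp add: form3_swap(2)[of _ _ "e j" "e k"])
    next
      case 3 then show ?thesis using assms[of j i k] ijk by (simp add: form3_swap(1)[of _ "e i" "e j"])
    next
      case 4 then show ?thesis using assms[of j k i] ijk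
        by (simp add: form3_swap(1)[of _ "e i" "e j"] form3_swap(2)[of _ _ "e i" "e k"])
    next
      case 5 then show ?thesis using assms[of k i j] ijk
        by (simp add: form3_swap(2)[of _ _ "e j" "e k"] form3_swap(1)[of _ "e i" "e k"])
    next
      case 6 then show ?thesis using assms[of k j i] ijk by (simp add: form3_swap(3)[of _ "e i" "e j" "e k"])
    qed
    then show "form3_apply (\<zeta> - \<eta>) vs = 0" by (simp add: minus_form3.rep_eq)
  qed
  then show ?thesis by (intro form3_eqI) (simp add: minus_form3.rep_eq)
qed

definition unit_map :: "nat \<Rightarrow> nat \<Rightarrow> 'v \<Rightarrow>\<^sub>L 'v" where
  "unit_map i j = blinfun_scaleR_left (e i) o\<^sub>L \<alpha> j"

lemma unit_map_apply: "unit_map i j v = \<alpha> j v *\<^sub>R e i"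
  by (simp add: unit_map_def)

text \<open>A right inverse of the differential \<open>A \<mapsto> pull_deriv A \<omega>\<close> of the orbit map: the entry in row
  \<open>i\<close>, column \<open>j\<close> of \<open>A\<close> replaces \<open>\<alpha>\<^sub>i\<close> by \<open>\<alpha>\<^sub>j\<close> in \<open>\<omega>\<close>, which yields each basic 3-form
  \<open>\<alpha>\<^sub>p \<and> \<alpha>\<^sub>q \<and> \<alpha>\<^sub>r\<close> up to a small linear system.\<close>

definition orbit_lift :: "'v form3 \<Rightarrow> 'v \<Rightarrow>\<^sub>L 'v" where
  "orbit_lift h = (let c = (\<lambda>p q r. form3_apply h [e p, e q, e r]) in
     (1 / 2 * (c 1 2 3 + c 1 4 5 - c 2 4 6 + c 3 5 6)) *\<^sub>R unit_map 1 1
     + (c 2 4 5) *\<^sub>R unit_map 1 2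
     + (c 3 4 5) *\<^sub>R unit_map 1 3
     + (c 2 3 4) *\<^sub>R unit_map 1 4
     + (c 2 3 5) *\<^sub>R unit_map 1 5
     + (1 / 2 * (c 1 2 4 - c 1 3 5 + c 2 3 6 + c 4 5 6)) *\<^sub>R unit_map 1 6
     + (c 1 4 6) *\<^sub>R unit_map 2 1
     + (1 / 2 * (c 1 2 3 - c 1 4 5 + c 2 4 6 + c 3 5 6)) *\<^sub>R unit_map 2 2
     + (c 3 4 6) *\<^sub>R unit_map 2 3
     + (- c 1 3 4) *\<^sub>R unit_map 2 4
     + (1 / 2 * (- c 1 2 4 - c 1 3 5 + c 2 3 6 - c 4 5 6)) *\<^sub>R unit_map 2 5
     + (- c 1 3 6) *\<^sub>R unit_map 2 6
     + (- c 1 5 6) *\<^sub>R unit_map 3 1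
     + (- c 2 5 6) *\<^sub>R unit_map 3 2
     + (- c 3 5 6) *\<^sub>R unit_map 3 3
     + (c 1 2 4) *\<^sub>R unit_map 3 4
     + (c 1 2 5) *\<^sub>R unit_map 3 5
     + (c 1 2 6) *\<^sub>R unit_map 3 6
     + (1 / 2 * (- c 1 2 4 + c 1 3 5 + c 2 3 6 - c 4 5 6)) *\<^sub>R unit_map 4 3
     + (1 / 2 * (- c 1 2 3 + c 1 4 5 + c 2 4 6 - c 3 5 6)) *\<^sub>R unit_map 4 4)"

lemma bounded_linear_orbit_lift: "bounded_linear orbit_lift"
  unfolding orbit_lift_def Let_def
  by (intro bounded_linear_add bounded_linear_sub bounded_linear_minus bounded_linear_scaleR_const
      bounded_linear_const_mult bounded_linear_form3_apply)

lemma orbit_lift_coordinates: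
  "\<alpha> 1 (orbit_lift h (e 1)) =
     1 / 2 * (form3_apply h [e 1, e 2, e 3] + form3_apply h [e 1, e 4, e 5]
       - form3_apply h [e 2, e 4, e 6] + form3_apply h [e 3, e 5, e 6])"
  "\<alpha> 1 (orbit_lift h (e 2)) = form3_apply h [e 2, e 4, e 5]"
  "\<alpha> 1 (orbit_lift h (e 3)) = form3_apply h [e 3, e 4, e 5]"
  "\<alpha> 1 (orbit_lift h (e 4)) = form3_apply h [e 2, e 3, e 4]"
  "\<alpha> 1 (orbit_lift h (e 5)) = form3_apply h [e 2, e 3, e 5]"
  "\<alpha> 1 (orbit_lift h (e 6)) =
     1 / 2 * (form3_apply h [e 1, e 2, e 4] - form3_apply h [e 1, e 3, e 5]
       + form3_apply h [e 2, e 3, e 6] + form3_apply h [e 4, e 5, e 6])"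
  "\<alpha> 2 (orbit_lift h (e 1)) = form3_apply h [e 1, e 4, e 6]"
  "\<alpha> 2 (orbit_lift h (e 2)) =
     1 / 2 * (form3_apply h [e 1, e 2, e 3] - form3_apply h [e 1, e 4, e 5]
       + form3_apply h [e 2, e 4, e 6] + form3_apply h [e 3, e 5, e 6])"
  "\<alpha> 2 (orbit_lift h (e 3)) = form3_apply h [e 3, e 4, e 6]"
  "\<alpha> 2 (orbit_lift h (e 4)) = - form3_apply h [e 1, e 3, e 4]"
  "\<alpha> 2 (orbit_lift h (e 5)) =
     1 / 2 * (- form3_apply h [e 1, e 2, e 4] - form3_apply h [e 1, e 3, e 5]
       + form3_apply h [e 2, e 3, e 6] - form3_apply h [e 4, e 5, e 6])"
  "\<alpha> 2 (orbit_lift h (e 6)) = - form3_apply h [e 1, e 3, e 6]"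
  "\<alpha> 3 (orbit_lift h (e 1)) = - form3_apply h [e 1, e 5, e 6]"
  "\<alpha> 3 (orbit_lift h (e 2)) = - form3_apply h [e 2, e 5, e 6]"
  "\<alpha> 3 (orbit_lift h (e 3)) = - form3_apply h [e 3, e 5, e 6]"
  "\<alpha> 3 (orbit_lift h (e 4)) = form3_apply h [e 1, e 2, e 4]"
  "\<alpha> 3 (orbit_lift h (e 5)) = form3_apply h [e 1, e 2, e 5]"
  "\<alpha> 3 (orbit_lift h (e 6)) = form3_apply h [e 1, e 2, e 6]"
  "\<alpha> 4 (orbit_lift h (e 1)) = 0"
  "\<alpha> 4 (orbit_lift h (e 2)) = 0"
  "\<alpha> 4 (orbit_lift h (e 3)) =
     1 / 2 * (- form3_apply h [e 1, e 2, e 4] + form3_apply h [e 1, e 3, e 5]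
       + form3_apply h [e 2, e 3, e 6] - form3_apply h [e 4, e 5, e 6])"
  "\<alpha> 4 (orbit_lift h (e 4)) =
     1 / 2 * (- form3_apply h [e 1, e 2, e 3] + form3_apply h [e 1, e 4, e 5]
       + form3_apply h [e 2, e 4, e 6] - form3_apply h [e 3, e 5, e 6])"
  "\<alpha> 4 (orbit_lift h (e 5)) = 0"
  "\<alpha> 4 (orbit_lift h (e 6)) = 0"
  "\<alpha> 5 (orbit_lift h (e 1)) = 0"
  "\<alpha> 5 (orbit_lift h (e 2)) = 0"
  "\<alpha> 5 (orbit_lift h (e 3)) = 0"
  "\<alpha> 5 (orbit_lift h (e 4)) = 0"
  "\<alpha> 5 (orbit_lift h (e 5)) = 0"
  "\<alpha> 5 (orbit_lift h (e 6)) = 0"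
  "\<alpha> 6 (orbit_lift h (e 1)) = 0"
  "\<alpha> 6 (orbit_lift h (e 2)) = 0"
  "\<alpha> 6 (orbit_lift h (e 3)) = 0"
  "\<alpha> 6 (orbit_lift h (e 4)) = 0"
  "\<alpha> 6 (orbit_lift h (e 5)) = 0"
  "\<alpha> 6 (orbit_lift h (e 6)) = 0"
  by (simp_all only: orbit_lift_def Let_def unit_map_apply blinfun.add_left blinfun.scaleR_left
      blinfun.add_right blinfun.scaleR_right dual_table real_scaleR_def
      mult_zero_right mult_1_right add_0_right add_0_left)

text \<open>Twelve basic forms each come from one matrix entry that produces nothing else. The other
  eight split into two systems: the diagonal entries 11, 22, 33, 44 yield the triples 123, 145, 246,
  356, and the entries 16, 25, 34, 43 yield 124, 135, 236, 456. In each, one unknown is immediate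
  and the other three are known through pairwise sums or differences, whence the halves.\<close>

lemma pull_deriv_orbit_lift: "pull_deriv (orbit_lift h) (omega_form \<alpha>) = h"
proof (rule form3_eqI_es)
  fix i j k :: nat
  have *: "form3_apply (pull_deriv (orbit_lift h) (omega_form \<alpha>)) [e 1, e 2, e 3] = form3_apply h [e 1, e 2, e 3]"
    "form3_apply (pull_deriv (orbit_lift h) (omega_form \<alpha>)) [e 1, e 2, e 4] = form3_apply h [e 1, e 2, e 4]"
    "form3_apply (pull_deriv (orbit_lift h) (omega_form \<alpha>)) [e 1, e 2, e 5] = form3_apply h [e 1, e 2, e 5]"
    "form3_apply (pull_deriv (orbit_lift h) (omega_form \<alpha>)) [e 1, e 2, e 6] = form3_apply h [e 1, e 2, e 6]"
    "form3_apply (pull_deriv (orbit_lift h) (omega_form \<alpha>)) [e 1, e 3, e 4] = form3_apply h [e 1, e 3, e 4]"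
    "form3_apply (pull_deriv (orbit_lift h) (omega_form \<alpha>)) [e 1, e 3, e 5] = form3_apply h [e 1, e 3, e 5]"
    "form3_apply (pull_deriv (orbit_lift h) (omega_form \<alpha>)) [e 1, e 3, e 6] = form3_apply h [e 1, e 3, e 6]"
    "form3_apply (pull_deriv (orbit_lift h) (omega_form \<alpha>)) [e 1, e 4, e 5] = form3_apply h [e 1, e 4, e 5]"
    "form3_apply (pull_deriv (orbit_lift h) (omega_form \<alpha>)) [e 1, e 4, e 6] = form3_apply h [e 1, e 4, e 6]"
    "form3_apply (pull_deriv (orbit_lift h) (omega_form \<alpha>)) [e 1, e 5, e 6] = form3_apply h [e 1, e 5, e 6]"
    "form3_apply (pull_deriv (orbit_lift h) (omega_form \<alpha>)) [e 2, e 3, e 4] = form3_apply h [e 2, e 3, e 4]"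
    "form3_apply (pull_deriv (orbit_lift h) (omega_form \<alpha>)) [e 2, e 3, e 5] = form3_apply h [e 2, e 3, e 5]"
    "form3_apply (pull_deriv (orbit_lift h) (omega_form \<alpha>)) [e 2, e 3, e 6] = form3_apply h [e 2, e 3, e 6]"
    "form3_apply (pull_deriv (orbit_lift h) (omega_form \<alpha>)) [e 2, e 4, e 5] = form3_apply h [e 2, e 4, e 5]"
    "form3_apply (pull_deriv (orbit_lift h) (omega_form \<alpha>)) [e 2, e 4, e 6] = form3_apply h [e 2, e 4, e 6]"
    "form3_apply (pull_deriv (orbit_lift h) (omega_form \<alpha>)) [e 2, e 5, e 6] = form3_apply h [e 2, e 5, e 6]"
    "form3_apply (pull_deriv (orbit_lift h) (omega_form \<alpha>)) [e 3, e 4, e 5] = form3_apply h [e 3, e 4, e 5]"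
    "form3_apply (pull_deriv (orbit_lift h) (omega_form \<alpha>)) [e 3, e 4, e 6] = form3_apply h [e 3, e 4, e 6]"
    "form3_apply (pull_deriv (orbit_lift h) (omega_form \<alpha>)) [e 3, e 5, e 6] = form3_apply h [e 3, e 5, e 6]"
    "form3_apply (pull_deriv (orbit_lift h) (omega_form \<alpha>)) [e 4, e 5, e 6] = form3_apply h [e 4, e 5, e 6]"
    by (simp_all only: pull_deriv.rep_eq pull_deriv_fun_def list.case omega_apply orbit_lift_coordinates
        dual_table mult_zero_left mult_zero_right mult_1_left mult_1_right add_0_left add_0_right
        diff_0_right diff_0 minus_zero)
      (simp_all add: field_simps)
  assume "i \<in> {1..6}" "j \<in> {1..6}" "k \<in> {1..6}" "i < j" "j < k"
  then show "form3_apply (pull_deriv (orbit_lift h) (omega_form \<alpha>)) [e i, e j, e k]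
      = form3_apply h [e i, e j, e k]"
    unfolding set_1_6 by (elim insertE emptyE) (simp_all add: *)
qed

end

section \<open>Openness of the orbit\<close>

lemma bij_id_plus_small:
  fixes B :: "'v::euclidean_space \<Rightarrow>\<^sub>L 'v"
  assumes "norm B < 1"
  shows "bij (blinfun_apply (id_blinfun + B))"
proof -
  have lin: "linear (blinfun_apply (id_blinfun + B))"
    using blinfun.bounded_linear_right bounded_linear.linear by blast
  have "v = 0" if "(id_blinfun + B) v = 0" for v
  proof (rule ccontr)
    assume "v \<noteq> 0"
    have "v = - B v" using that by (simp add: blinfun.add_left eq_neg_iff_add_eq_0)
    then have "norm v = norm (B v)" by (metis norm_minus_cancel)
    also have "\<dots> \<le> norm B * norm v" by (rule norm_blinfun)
    also have "\<dots> < 1 * norm v" using assms \<open>v \<noteq> 0\<close> by (intro mult_strict_right_mono) auto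
    finally show False by simp
  qed
  then have "inj (blinfun_apply (id_blinfun + B))" using linear_injective_0[OF lin] by blast
  then show ?thesis using linear_inj_imp_surj[OF lin] by (simp add: bij_def)
qed

text \<open>Perturbing the identity by \<open>orbit_lift h\<close> gives a map of the space of forms
  into itself whose derivative at 0 is the identity. Its image near 0 is a neighbourhood of the
  model form and, as small perturbations stay invertible, lies in the orbit.\<close>

lemma (in dual_bases) omega_in_interior:
  assumes dim: "DIM('v) = 6"
  shows "omega_form \<alpha> \<in> interior (U_minus \<alpha>)"
proof -
  define U0 where "U0 = {h. norm (orbit_lift h) < 1}"
  define \<Psi> where "\<Psi> h = pull (id_blinfun + orbit_lift h) (omega_form \<alpha>)" for h
  interpret g: bounded_linear orbit_lift by (rule bounded_linear_orbit_lift)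
  have "continuous_on UNIV (\<lambda>h. norm (orbit_lift h))"
    by (intro continuous_on_norm linear_continuous_on bounded_linear_orbit_lift)
  then have U0: "open U0" unfolding U0_def by (intro open_Collect_less continuous_on_const)
  have der: "((\<lambda>h. form3_coord i (\<Psi> h)) has_derivative
      (\<lambda>k. case i of (a, b, c) \<Rightarrow>
        form3_apply (omega_form \<alpha>) [orbit_lift k a, b + orbit_lift x b, c + orbit_lift x c]
      + form3_apply (omega_form \<alpha>) [a + orbit_lift x a, orbit_lift k b, c + orbit_lift x c]
      + form3_apply (omega_form \<alpha>) [a + orbit_lift x a, b + orbit_lift x b, orbit_lift k c])) (at x)"
    for i x
  proof (cases i)
    case (fields a b c)
    have X: "((\<lambda>h. v + orbit_lift h v) has_derivative (\<lambda>k. orbit_lift k v)) (at x)" for v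
    proof -
      have "((\<lambda>h. orbit_lift h v) has_derivative (\<lambda>k. orbit_lift k v)) (at x)"
        by (rule bounded_linear.has_derivative[OF blinfun.bounded_linear_left
              bounded_linear_imp_has_derivative[OF bounded_linear_orbit_lift]])
      from has_derivative_add[OF has_derivative_const[of v] this] show ?thesis by simp
    qed
    have "((\<lambda>h. form3_apply (omega_form \<alpha>) [a + orbit_lift h a, b + orbit_lift h b, c + orbit_lift h c])
        has_derivative (\<lambda>k. form3_apply 0 [a + orbit_lift x a, b + orbit_lift x b, c + orbit_lift x c]
      + form3_apply (omega_form \<alpha>) [orbit_lift k a, b + orbit_lift x b, c + orbit_lift x c]
      + form3_apply (omega_form \<alpha>) [a + orbit_lift x a, orbit_lift k b, c + orbit_lift x c]
      + form3_apply (omega_form \<alpha>) [a + orbit_lift x a, b + orbit_lift x b, orbit_lift k c])) (at x)"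
      by (intro has_derivative_form3_apply has_derivative_const X)
    then show ?thesis
      by (simp add: fields form3_coord_def \<Psi>_def pull.rep_eq blinfun.add_left zero_form3.rep_eq)
  qed
  \<comment> \<open>The type \<open>6 \<times> 6 \<times> 6\<close> serves as an index type with as
    many elements as the frame.\<close>
  have card: "card ((Basis :: 'v set) \<times> (Basis :: 'v set) \<times> (Basis :: 'v set)) = CARD(6 \<times> 6 \<times> 6)"
    using dim by simp
  obtain \<beta> :: "6 \<times> 6 \<times> 6 \<Rightarrow> 'v \<times> 'v \<times> 'v" where \<beta>: "bij_betw \<beta> UNIV (Basis \<times> Basis \<times> Basis)"
    using finite_same_card_bij[OF finite[of UNIV] _ card[symmetric]] by auto
  have 0: "0 \<in> U0" by (simp add: U0_def g.zero)
  have "\<Psi> 0 \<in> interior (\<Psi> ` U0)"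
  proof (rule open_mapping_frame[OF finite_frame_form3 \<beta> U0 0])
    show "continuous_on U0 \<Psi>"
    proof (rule continuous_on_frame[OF finite_frame_form3])
      show "continuous_on U0 (\<lambda>y. form3_coord i (\<Psi> y))" for i
        using has_derivative_continuous[OF der] by (intro continuous_at_imp_continuous_on) blast
    qed
    show "(\<Psi> has_derivative (\<lambda>h. h)) (at 0)"
    proof (rule has_derivative_frame[OF finite_frame_form3])
      fix i :: "'v \<times> 'v \<times> 'v"
      obtain a b c where i: "i = (a, b, c)" by (cases i)
      have "form3_apply (omega_form \<alpha>) [orbit_lift k a, b, c] + form3_apply (omega_form \<alpha>) [a, orbit_lift k b, c]
        + form3_apply (omega_form \<alpha>) [a, b, orbit_lift k c] = form3_apply k [a, b, c]" for k
        using arg_cong[OF pull_deriv_orbit_lift[of k], of "\<lambda>z. form3_apply z [a, b, c]"]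
        by (simp add: pull_deriv.rep_eq pull_deriv_fun_def)
      then show "((\<lambda>h. form3_coord i (\<Psi> h)) has_derivative form3_coord i) (at 0)"
        using der[of i 0] by (simp add: i g.zero form3_coord_def)
    qed
  qed
  moreover have "\<Psi> ` U0 \<subseteq> U_minus \<alpha>"
    unfolding U_minus_eq \<Psi>_def U0_def using bij_id_plus_small by blast
  moreover have "\<Psi> 0 = omega_form \<alpha>"
    by (rule form3_eqI) (simp add: \<Psi>_def g.zero pull.rep_eq id_blinfun.rep_eq)
  ultimately show ?thesis using interior_mono[of "\<Psi> ` U0" "U_minus \<alpha>"] by auto
qed

text \<open>Homogeneity: pullback by the inverse of A is continuous, preserves the orbit and sends
  zeta to the model form, so it transports interior points.\<close>

lemma (in dual_bases) open_U_minus: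
  assumes dim: "DIM('v) = 6"
  shows "open (U_minus \<alpha>)"
proof -
  have "\<zeta> \<in> interior (U_minus \<alpha>)" if \<zeta>: "\<zeta> \<in> U_minus \<alpha>" for \<zeta>
  proof -
    obtain A where A: "bij (blinfun_apply A)" "\<zeta> = pull A (omega_form \<alpha>)"
      using \<zeta> unfolding U_minus_eq by blast
    have "linear (blinfun_apply A)" using blinfun.bounded_linear_right bounded_linear.linear by blast
    then have "linear (inv A)" by (rule inj_linear_imp_inv_linear[OF _ bij_is_inj[OF A(1)]])
    then have inv: "blinfun_apply (Blinfun (inv A)) = inv A"
      by (simp add: bounded_linear_Blinfun_apply linear_conv_bounded_linear)
    have *: "A o\<^sub>L Blinfun (inv A) = id_blinfun" "Blinfun (inv A) o\<^sub>L A = id_blinfun"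
      using A(1) by (auto intro!: blinfun_eqI simp: inv bij_is_surj surj_f_inv_f bij_is_inj)
    have id: "pull id_blinfun \<eta> = \<eta>" for \<eta> :: "'v form3"
      by (rule form3_eqI) (simp add: pull.rep_eq id_blinfun.rep_eq)
    define W where "W = pull (Blinfun (inv A)) -` interior (U_minus \<alpha>)"
    have "open W"
      unfolding W_def by (rule continuous_open_vimage) (auto intro: continuous_pull)
    moreover have "\<zeta> \<in> W"
      using omega_in_interior[OF dim] by (simp add: W_def A pull_pull * id)
    moreover have "W \<subseteq> U_minus \<alpha>"
    proof
      fix \<eta> assume "\<eta> \<in> W"
      then have "pull (Blinfun (inv A)) \<eta> \<in> U_minus \<alpha>" using interior_subset by (auto simp: W_def)
      then obtain B where B: "bij (blinfun_apply B)" "pull (Blinfun (inv A)) \<eta> = pull B (omega_form \<alpha>)"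
        unfolding U_minus_eq by blast
      from arg_cong[OF B(2), of "pull A"] have "\<eta> = pull (B o\<^sub>L A) (omega_form \<alpha>)"
        by (simp add: pull_pull * id)
      moreover have "bij (blinfun_apply (B o\<^sub>L A))"
        using A(1) B(1) by (simp add: blinfun_compose.rep_eq bij_comp)
      ultimately show "\<eta> \<in> U_minus \<alpha>" unfolding U_minus_eq by blast
    qed
    ultimately show ?thesis by (rule interiorI)
  qed
  then have "interior (U_minus \<alpha>) = U_minus \<alpha>" using interior_subset by blast
  then show ?thesis by (simp only: interior_eq)
qed

section \<open>Integrability\<close>

lemma smooth_on_wedge_2_3:
  fixes U :: "'v::euclidean_space form3 set"
  assumes "open U"
  shows "smooth_on U (\<lambda>\<zeta>. wedge 2 3 (interior_prod v (form3_apply \<zeta>)) (form3_apply \<zeta>) [a, b, c, d, e])"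
proof -
  have "smooth_on U (\<lambda>\<zeta>. form3_apply \<zeta> [x, y, z])" for x y z :: 'v
    by (rule smooth_on_linear[OF assms bounded_linear_form3_apply])
  then show ?thesis
    unfolding wedge_2_3_eq by (intro smooth_on_add smooth_on_diff smooth_on_mult assms)
qed

lemma smooth_on_form3_apply:
  fixes \<Omega> :: "'v::euclidean_space form3"
  assumes U: "open U" and "smooth_on U X" "smooth_on U Y" "smooth_on U Z"
  shows "smooth_on U (\<lambda>y. form3_apply \<Omega> [X y, Y y, Z y])"
proof -
  have "smooth_on U (\<lambda>y. \<Sum>a\<in>Basis. \<Sum>b\<in>Basis. \<Sum>c\<in>Basis.
      (X y \<bullet> a) * (Y y \<bullet> b) * (Z y \<bullet> c) * form3_apply \<Omega> [a, b, c])"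
    by (intro smooth_on_sum smooth_on_mult smooth_on_const U assms
        smooth_on_bounded_linear_compose[OF U bounded_linear_inner_left])
  then show ?thesis by (simp only: form3_expand[symmetric])
qed

lemma J2_op_apply:
  "form3_apply (J2_op J \<Omega>) [u, v, w] = 1/2 * form3_apply \<Omega> [J u, J v, J w]
     + 1/2 * (form3_apply \<Omega> [J u, v, w] + form3_apply \<Omega> [u, J v, w] + form3_apply \<Omega> [u, v, J w])"
  by (simp add: J2_op.rep_eq J2_fun_def)

lemma linear_J2_op: "linear (J2_op J)"
  by (rule linearI; rule form3_eqI')
    (simp_all add: J2_op_apply plus_form3.rep_eq scaleR_form3.rep_eq algebra_simps)

text \<open>On complexified forms the operator is i on types (3,0) and (2,1), as (- i + 3 i) / 2 = i
  and (i + i) / 2 = i, and - i on the conjugate types; hence its square is - 1. The proof is the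
  direct expansion.\<close>

lemma J2_op_J2_op:
  fixes J :: "'v::euclidean_space \<Rightarrow>\<^sub>L 'v"
  assumes "\<And>v. J (J v) = - v"
  shows "J2_op J (J2_op J \<Omega>) = - \<Omega>"
proof -
  note neg = form3_linear[THEN linear_neg]
  show ?thesis
    by (rule form3_eqI') (simp add: J2_op_apply assms neg uminus_form3.rep_eq, simp add: field_simps)
qed

lemma finite_frame_dual: "dual_bases \<alpha> e \<Longrightarrow> finite_frame {1..6} (\<lambda>i. blinfun_apply (\<alpha> i)) e"
  by (auto simp: finite_frame_def dual_bases_def intro: blinfun.bounded_linear_right)

context dual_bases
begin

text \<open>The quantities \<open>k i v\<close> are the coordinates of K v for K = a J, quadratic in
  zeta. The unknown factor a is recovered from K itself, because K^2 = - a^2.\<close>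

lemma smooth_on_J_form:
  assumes U: "open (U_minus \<alpha>)" and \<theta>: "is_form 6 \<theta>" "\<theta> es \<noteq> 0"
  shows "smooth_on (U_minus \<alpha>) (\<lambda>\<zeta>. J_form \<theta> \<zeta> v)"
proof -
  define W where "W i v \<zeta> = wedge 2 3 (interior_prod v (form3_apply \<zeta>)) (form3_apply \<zeta>) (remove1 (e i) es)"
    for i v \<zeta>
  define k where "k i v \<zeta> = inverse (\<theta> (e i # remove1 (e i) es)) * W i v \<zeta>" for i v \<zeta>
  \<comment> \<open>Minus the (1,1) entry of K^2, which equals a^2.\<close>
  define Q where "Q \<zeta> = - (\<Sum>i = 1..6. k i (e 1) \<zeta> * k 1 (e i) \<zeta>)" for \<zeta>
  have co: "\<theta> (x # remove1 (e i) es) = \<alpha> i x * \<theta> (e i # remove1 (e i) es)"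
    "\<theta> (e i # remove1 (e i) es) \<noteq> 0" if "i \<in> {1..6}" for i x
    using that \<theta>(2) unfolding set_1_6 by (auto simp: form6_coordinates[OF \<theta>(1)])
  have sW: "smooth_on (U_minus \<alpha>) (W i v)" if "i \<in> {1..6}" for i v
    using that unfolding W_def set_1_6
    by (auto simp: remove1_es intro: smooth_on_wedge_2_3[OF U])
  have sk: "smooth_on (U_minus \<alpha>) (k i v)" if "i \<in> {1..6}" for i v
    unfolding k_def by (intro smooth_on_mult smooth_on_const U sW that)
  have sQ: "smooth_on (U_minus \<alpha>) Q"
    unfolding Q_def by (intro smooth_on_uminus smooth_on_sum smooth_on_mult sk U) auto
  have key: "Q \<zeta> > 0 \<and> (\<forall>i\<in>{1..6}. \<forall>v. \<alpha> i (J_form \<theta> \<zeta> v) = k i v \<zeta> * inverse (sqrt (Q \<zeta>)))"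
    if \<zeta>: "\<zeta> \<in> U_minus \<alpha>" for \<zeta>
  proof -
    obtain a where a: "a > 0" "\<And>v. wedge 2 3 (interior_prod v (form3_apply \<zeta>)) (form3_apply \<zeta>)
                = interior_prod (J_form \<theta> \<zeta> v) (\<lambda>vs. a * \<theta> vs)"
      using J_form_wedge[OF \<theta> \<zeta>] by blast
    have k: "k i v \<zeta> = a * \<alpha> i (J_form \<theta> \<zeta> v)" if "i \<in> {1..6}" for i v
      using co(2)[OF that] by (simp add: k_def W_def a(2) interior_prod_def co(1)[OF that, of "J_form \<theta> \<zeta> v"])
    let ?J = "J_form \<theta> \<zeta>"
    have "\<alpha> 1 (?J (?J (e 1))) = \<alpha> 1 (?J (\<Sum>i = 1..6. \<alpha> i (?J (e 1)) *\<^sub>R e i))"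
      by (simp only: sum_dual)
    also have "\<dots> = (\<Sum>i = 1..6. \<alpha> i (?J (e 1)) * \<alpha> 1 (?J (e i)))"
      by (simp add: blinfun.sum_right blinfun.scaleR_right)
    finally have "(\<Sum>i = 1..6. \<alpha> i (?J (e 1)) * \<alpha> 1 (?J (e i))) = - 1"
      using J_form_sq[OF \<theta> \<zeta>] by (simp add: blinfun.minus_right)
    moreover have "Q \<zeta> = - (a\<^sup>2 * (\<Sum>i = 1..6. \<alpha> i (?J (e 1)) * \<alpha> 1 (?J (e i))))"
      unfolding Q_def sum_distrib_left by (auto simp: k power2_eq_square intro!: sum.cong)
    ultimately have Q: "Q \<zeta> = a\<^sup>2" by simp
    then show ?thesis using a(1) by (simp add: k)
  qed
  show ?thesis
  proof (rule smooth_on_frame[OF finite_frame_dual U])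
    show "dual_bases \<alpha> e" by unfold_locales
    fix i :: nat assume i: "i \<in> {1..6}"
    have "smooth_on (U_minus \<alpha>) (\<lambda>\<zeta>. k i v \<zeta> * inverse (sqrt (Q \<zeta>)))"
      by (intro smooth_on_mult smooth_on_inverse_sqrt U sk sQ i) (use key in auto)
    then show "smooth_on (U_minus \<alpha>) (\<lambda>\<zeta>. \<alpha> i (J_form \<theta> \<zeta> v))"
      by (rule smooth_on_cong[OF U, rotated]) (use key i in auto)
  qed
qed

lemma almost_complex_J2:
  assumes U: "open (U_minus \<alpha>)" and \<theta>: "is_form 6 \<theta>" "\<theta> es \<noteq> 0"
  shows "almost_complex_structure_on (U_minus \<alpha>) (J2 \<theta>)"
  unfolding almost_complex_structure_on_def
proof (intro conjI ballI allI)
  fix \<zeta> assume "\<zeta> \<in> U_minus \<alpha>"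
  then show "J2 \<theta> \<zeta> (J2 \<theta> \<zeta> \<Omega>) = - \<Omega>" for \<Omega>
    unfolding J2_def by (intro J2_op_J2_op J_form_sq[OF \<theta>])
  show "linear (J2 \<theta> \<zeta>)" using linear_J2_op[of "J_form \<theta> \<zeta>"] by (simp add: J2_def[abs_def])
next
  fix \<Omega> :: "'v form3"
  note sJ = smooth_on_J_form[OF U \<theta>]
  show "smooth_on (U_minus \<alpha>) (\<lambda>\<zeta>. J2 \<theta> \<zeta> \<Omega>)"
  proof (rule smooth_on_frame[OF finite_frame_form3 U])
    fix i :: "'v \<times> 'v \<times> 'v"
    obtain a b c where i: "i = (a, b, c)" by (cases i)
    show "smooth_on (U_minus \<alpha>) (\<lambda>\<zeta>. form3_coord i (J2 \<theta> \<zeta> \<Omega>))"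
      unfolding i form3_coord_def prod.case J2_def J2_op_apply
      by (intro smooth_on_add smooth_on_mult smooth_on_const smooth_on_form3_apply sJ U)
  qed
qed

text \<open>The potential: \<open>J2\<close> is the differential of \<open>\<zeta> \<mapsto> - \<zeta>(J\<cdot>, J\<cdot>, J\<cdot>) = \<zeta>(J\<cdot>, \<cdot>, \<cdot>)\<close>. The variation
  \<open>J'\<close> of \<open>J\<close> along \<open>h\<close> enters only through \<open>f(v, w, u) = \<zeta>(J' v, w, u)\<close>, which is determined by
  \<open>J\<^sup>2 = - 1\<close> and by differentiating \<open>\<zeta>(J v, w, u) = \<zeta>(v, J w, u)\<close>.\<close>

lemma has_derivative_potential:
  assumes U: "open (U_minus \<alpha>)" and \<theta>: "is_form 6 \<theta>" "\<theta> es \<noteq> 0" and x: "x \<in> U_minus \<alpha>"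
  shows "((\<lambda>\<zeta>. - pull (J_form \<theta> \<zeta>) \<zeta>) has_derivative J2 \<theta> x) (at x)"
proof (rule has_derivative_frame[OF finite_frame_form3])
  fix i :: "'v \<times> 'v \<times> 'v"
  obtain a b c where i: "i = (a, b, c)" by (cases i)
  note neg = form3_linear[THEN linear_neg]
  define J where "J = J_form \<theta> x"
  define J' where "J' h v = frechet_derivative (\<lambda>\<zeta>. J_form \<theta> \<zeta> v) (at x) h" for h v
  have J': "((\<lambda>\<zeta>. J_form \<theta> \<zeta> v) has_derivative (\<lambda>h. J' h v)) (at x)" for v
    unfolding J'_def by (rule smooth_on_has_derivative[OF smooth_on_J_form[OF U \<theta>] x])
  have JJ: "J (J v) = - v" for v unfolding J_def by (rule J_form_sq[OF \<theta> x])
  have sym: "form3_apply x [J v, w, u] = form3_apply x [v, J w, u]" for v w u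
    unfolding J_def by (rule J_form_sym[OF \<theta> x])
  have sym': "form3_apply x [v, J w, u] = form3_apply x [v, w, J u]" for v w u
    by (smt (verit) form3_swap sym)
  have anti: "J' h (J v) = - J (J' h v)" for h v
  proof -
    have "((\<lambda>\<zeta>. J_form \<theta> \<zeta> (J_form \<theta> \<zeta> v)) has_derivative
        (\<lambda>h. J' h (J_form \<theta> x v) + J_form \<theta> x (J' h v))) (at x)"
      by (rule has_derivative_apply_linear[OF finite_frame_Basis U x _ J' J'])
        (rule blinfun.bounded_linear_right[THEN bounded_linear.linear])
    moreover have "((\<lambda>\<zeta>. J_form \<theta> \<zeta> (J_form \<theta> \<zeta> v)) has_derivative (\<lambda>h. 0)) (at x)"
      by (rule has_derivative_transform_within_open[OF has_derivative_const[of "- v"] U x])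
        (simp add: J_form_sq[OF \<theta>])
    ultimately have "(\<lambda>h. J' h (J_form \<theta> x v) + J_form \<theta> x (J' h v)) = (\<lambda>h. 0)"
      by (rule has_derivative_unique)
    from fun_cong[OF this, of h] show ?thesis by (simp add: J_def eq_neg_iff_add_eq_0)
  qed
  have D1: "((\<lambda>\<zeta>. form3_apply \<zeta> [J_form \<theta> \<zeta> v, w, u]) has_derivative
      (\<lambda>h. form3_apply h [J v, w, u] + form3_apply x [J' h v, w, u])) (at x)" for v w u
    using has_derivative_form3_apply[OF has_derivative_ident J'[of v] has_derivative_const[of w] has_derivative_const[of u]]
    by (simp add: J_def linear_0[OF form3_linear(2)] linear_0[OF form3_linear(3)])
  have D2: "((\<lambda>\<zeta>. form3_apply \<zeta> [v, J_form \<theta> \<zeta> w, u]) has_derivative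
      (\<lambda>h. form3_apply h [v, J w, u] + form3_apply x [v, J' h w, u])) (at x)" for v w u
    using has_derivative_form3_apply[OF has_derivative_ident has_derivative_const[of v] J'[of w] has_derivative_const[of u]]
    by (simp add: J_def linear_0[OF form3_linear(1)] linear_0[OF form3_linear(3)])
  have S: "form3_apply x [J' h v, w, u] + form3_apply x [J' h w, v, u]
      = form3_apply h [v, J w, u] - form3_apply h [J v, w, u]" for h v w u
  proof -
    have "((\<lambda>\<zeta>. form3_apply \<zeta> [J_form \<theta> \<zeta> v, w, u]) has_derivative
        (\<lambda>h. form3_apply h [v, J w, u] + form3_apply x [v, J' h w, u])) (at x)"
      by (rule has_derivative_transform_within_open[OF D2 U x]) (simp add: J_form_sym[OF \<theta>])
    from fun_cong[OF has_derivative_unique[OF D1 this], of h]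
    show ?thesis using form3_swap(1)[of x "J' h w" v u] by simp
  qed
  \<comment> \<open>\<open>S\<close> yields only the part of f symmetric in v and w. Replacing (w,
    u) by (J w, J u) changes the sign of f(v, w, u) and keeps f(w, v, u), so subtracting the two
    instances isolates 2 f(v, w, u).\<close>
  have f: "form3_apply x [J' h v, w, u] = 1/2 * form3_apply h [J v, J w, J u]
      + 1/2 * (- form3_apply h [J v, w, u] + form3_apply h [v, J w, u] + form3_apply h [v, w, J u])" for h v w u
  proof -
    have 1: "form3_apply x [J' h v, J w, J u] = - form3_apply x [J' h v, w, u]"
      by (simp add: sym' JJ neg)
    have 2: "form3_apply x [J' h (J w), v, J u] = form3_apply x [J' h w, v, u]"
      by (simp add: anti neg sym sym' JJ)
    have 3: "form3_apply h [v, J (J w), J u] = - form3_apply h [v, w, J u]" by (simp add: JJ neg)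
    show ?thesis
      using S[of h v w u] S[of h v "J w" "J u"] unfolding 1 2 3 by (simp add: One_nat_def field_simps)
  qed
  \<comment> \<open>The full term h(J a, b, c), from differentiating zeta itself, turns the
    coefficient - 1/2 in \<open>f\<close> into the 1/2 of \<open>J2\<close>.\<close>
  have "((\<lambda>\<zeta>. form3_apply \<zeta> [J_form \<theta> \<zeta> a, b, c]) has_derivative (\<lambda>h. form3_coord i (J2 \<theta> x h))) (at x)"
    using D1[of a b c] unfolding f
    by (simp add: i form3_coord_def J2_def J2_op_apply J_def[symmetric] algebra_simps)
  then show "((\<lambda>\<zeta>. form3_coord i (- pull (J_form \<theta> \<zeta>) \<zeta>)) has_derivative (\<lambda>h. form3_coord i (J2 \<theta> x h))) (at x)"
  proof (rule has_derivative_transform_within_open[OF _ U x])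
    \<comment> \<open>On the orbit the potential equals zeta with J in one slot. Stated through
      \<open>pull\<close> it is alternating by construction; with J in one slot it is easier to
      differentiate.\<close>
    fix y assume y: "y \<in> U_minus \<alpha>"
    note s = J_form_sym[OF \<theta> y] and sq = J_form_sq[OF \<theta> y]
    have "form3_apply y [J_form \<theta> y a, J_form \<theta> y b, J_form \<theta> y c]
        = form3_apply y [J_form \<theta> y (J_form \<theta> y a), b, J_form \<theta> y c]" by (simp only: s)
    also have "\<dots> = - form3_apply y [a, b, J_form \<theta> y c]" by (simp add: sq neg)
    also have "form3_apply y [a, b, J_form \<theta> y c] = form3_apply y [J_form \<theta> y a, b, c]"
      by (smt (verit) form3_swap s)
    finally show "form3_apply y [J_form \<theta> y a, b, c] = form3_coord i (- pull (J_form \<theta> y) y)"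
      by (simp add: i form3_coord_def uminus_form3.rep_eq pull.rep_eq)
  qed
qed

end

theorem proposition5p2:
  fixes \<alpha> :: "nat \<Rightarrow> 'v::euclidean_space \<Rightarrow>\<^sub>L real"
    and \<theta>\<^sub>0 :: "'v list \<Rightarrow> real"
  assumes "DIM('v) = 6"
    and "is_dual_basis \<alpha>"
    and "is_form 6 \<theta>\<^sub>0" and "\<theta>\<^sub>0 \<noteq> (\<lambda>_. 0)"
  shows "integrable_acs_on (U_minus \<alpha>) (J2 \<theta>\<^sub>0)"
proof -
  obtain e where "dual_bases \<alpha> e" using dual_bases_exist[OF assms(1,2)] by blast
  then interpret dual_bases \<alpha> e .
  have \<theta>: "\<theta>\<^sub>0 es \<noteq> 0" by (rule form6_es_nonzero[OF assms(3,4)])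
  note U = open_U_minus[OF assms(1)]
  note J = almost_complex_J2[OF U assms(3) \<theta>]
  show ?thesis
    unfolding integrable_acs_on_def
    using J nijenhuis_derivative_eq_0[OF finite_frame_form3 U _ J has_derivative_potential[OF U assms(3) \<theta>]]
    by blast
qed

end
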